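(* Let $r$ be an odd prime and $1\le n<r$. Then the numbers $N_{\zeta^s}(n)$, $1\le s\le r$, are all equal, and the numbers $N_{-\zeta^s}(n)$, $1\le s\le r$, are all equal.
   Context: $G(n,r)=\mathbb{Z}_r^n\rtimes S_n$, where $\mathbb{Z}_r=\mathbb{Z}/r\mathbb{Z}$ and $S_n$ permutes coordinates; $G(0,r)$ is trivial. $P(n,r)$ is the set of $r$-tuples $\lambda=(\lambda_1,\dots,\lambda_r)$ of partitions (possibly empty) with $\sum_k|\lambda_k|=n$. Fix a primitive $r$-th root of unity $\zeta$; also write $\zeta$ for the character $\zeta(x;w)=\zeta^{x_1+\dots+x_n}$ of $G(n,r)$ and $\mathrm{sgn}(x;w)$ for the sign of $w$. For a partition $\mu$ of $m$, let $\rho_\mu$ be the corresponding irreducible complex representation of $S_m$ and $\rho_\mu^k(x;w)=\zeta^{k(x_1+\dots+x_m)}\rho_\mu(w)$ its extension to $G(m,r)$. With $a_k=|\lambda_k|$, the irreducible representation of $G(n,r)$ indexed by $\lambda$ is $$\rho_\lambda=\mathrm{Ind}_{G(a_1,r)\times\dots\times G(a_r,r)}^{G(n,r)}\ \rho_{\lambda_1}^{0}\boxtimes\rho_{\lambda_2}^{1}\boxtimes\dots\boxtimes\rho_{\lambda_r}^{r-1}.$$ $N_{\zeta^s}(n)$ (resp. $N_{-\zeta^s}(n)$) is the number of $\lambda\in P(n,r)$ such that the character $\det\rho_\lambda$ equals $\zeta^s$ (resp. $\zeta^s\cdot\mathrm{sgn}$); for $n=1$, where $\mathrm{sgn}$ is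 trivial, $N_{-\zeta^s}(1)=0$. *)

theory Defs
  imports
    "HOL-Algebra.Product_Groups"
    "HOL-Algebra.Elementary_Groups"
    "HOL-Algebra.Sym_Groups"
    "HOL-Library.Function_Algebras"
    "Jordan_Normal_Form.Determinant"
begin

section \<open>The groups \<open>G(n,r)\<close>\<close>

text \<open>The multiplication is \<open>(x;u)(y;v) = (x + u \<bullet> y; uv)\<close>.\<close>

definition semidirect_product ::
  "('a, 'c) monoid_scheme \<Rightarrow> ('b, 'd) monoid_scheme \<Rightarrow> ('b \<Rightarrow> 'a \<Rightarrow> 'a) \<Rightarrow> ('a \<times> 'b) monoid" where
  "semidirect_product N H act =
     \<lparr> carrier = carrier N \<times> carrier H,
       monoid.mult = (\<lambda>(x, u) (y, v). (x \<otimes>\<^bsub>N\<^esub> act u y, u \<otimes>\<^bsub>H\<^esub> v)),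
       one = (\<one>\<^bsub>N\<^esub>, \<one>\<^bsub>H\<^esub>) \<rparr>"

text \<open>\<open>S\<^sub>n\<close> acts on \<open>\<int>\<^sub>r\<^sup>n\<close> by \<open>(w \<bullet> y)\<^sub>i = y\<^bsub>w\<inverse>(i)\<^esub>\<close>; the residues mod \<open>r\<close> are the integers
  in \<open>{0..<r}\<close>.\<close>

type_synonym wreath_elem = "(nat \<Rightarrow> int) \<times> (nat \<Rightarrow> nat)"

definition wreath :: "nat \<Rightarrow> nat \<Rightarrow> wreath_elem monoid" where
  "wreath n r = semidirect_product
     (product_group {1..n} (\<lambda>_. integer_mod_group r)) (sym_group n)
     (\<lambda>w y. \<lambda>i\<in>{1..n}. y (inv' w i))"

definition primitive_root_of_unity :: "nat \<Rightarrow> complex \<Rightarrow> bool" where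
  "primitive_root_of_unity r z \<longleftrightarrow> z ^ r = 1 \<and> (\<forall>k\<in>{1..<r}. z ^ k \<noteq> 1)"

definition zeta_char :: "complex \<Rightarrow> nat \<Rightarrow> wreath_elem \<Rightarrow> complex" where
  "zeta_char \<zeta> n = (\<lambda>(x, w). \<zeta> powi (\<Sum>i\<in>{1..n}. x i))"

definition sgn_char :: "wreath_elem \<Rightarrow> complex" where
  "sgn_char = (\<lambda>(x, w). of_int (sign w))"


section \<open>Partitions and multipartitions\<close>

definition is_partition :: "nat list \<Rightarrow> bool" where
  "is_partition \<mu> \<longleftrightarrow> sorted_wrt (\<ge>) \<mu> \<and> 0 \<notin> set \<mu>"

text \<open>Components are indexed from 0: \<open>\<Lambda> ! k\<close> is the component usually written \<open>\<lambda>\<^bsub>k+1\<^esub>\<close>, which carries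
  the twist \<open>\<zeta>\<^sup>k\<close>.\<close>

definition multipartitions :: "nat \<Rightarrow> nat \<Rightarrow> nat list list set" where
  "multipartitions n r =
     {\<Lambda>. length \<Lambda> = r \<and> (\<forall>\<mu>\<in>set \<Lambda>. is_partition \<mu>) \<and> sum_list (map sum_list \<Lambda>) = n}"


section \<open>The irreducible representations of the symmetric groups\<close>

global_interpretation cfun: vector_space "\<lambda>(c::complex) (f::'a \<Rightarrow> complex) x. c * f x"
  by unfold_locales (auto simp: fun_eq_iff algebra_simps)

text \<open>The matrix of a linear map with respect to an ordered basis; its columns are the coordinates
  of the images of the basis vectors.\<close>

definition is_ordered_basis :: "('a \<Rightarrow> complex) set \<Rightarrow> ('a \<Rightarrow> complex) list \<Rightarrow> bool" where
  "is_ordered_basis V bs \<longleftrightarrow> distinct bs \<and> cfun.independent (set bs) \<and> cfun.span (set bs) = V"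

definition matrix_of ::
  "('a \<Rightarrow> complex) list \<Rightarrow> (('a \<Rightarrow> complex) \<Rightarrow> ('a \<Rightarrow> complex)) \<Rightarrow> complex mat" where
  "matrix_of bs T = mat (length bs) (length bs)
     (\<lambda>(i, j). cfun.representation (set bs) (T (bs ! j)) (bs ! i))"

text \<open>The group algebra of a finite group \<open>G\<close>: functions supported on \<open>carrier G\<close>, under convolution.\<close>

definition group_algebra :: "('g, 'm) monoid_scheme \<Rightarrow> ('g \<Rightarrow> complex) set" where
  "group_algebra G = {f. \<forall>g. g \<notin> carrier G \<longrightarrow> f g = 0}"

definition convolution ::
  "('g, 'm) monoid_scheme \<Rightarrow> ('g \<Rightarrow> complex) \<Rightarrow> ('g \<Rightarrow> complex) \<Rightarrow> 'g \<Rightarrow> complex" where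
  "convolution G f f' g =
     (if g \<in> carrier G then \<Sum>h\<in>carrier G. f h * f' (inv\<^bsub>G\<^esub> h \<otimes>\<^bsub>G\<^esub> g) else 0)"

definition delta :: "'g \<Rightarrow> 'g \<Rightarrow> complex" where
  "delta g = (\<lambda>h. of_bool (h = g))"

text \<open>The canonical tableau of shape \<open>\<mu>\<close>, in which \<open>1, \<dots>, |\<mu>|\<close> are entered row by row.  The row
  containing the entry \<open>i\<close> is counted from 0, its column from 1.\<close>

definition tableau_row :: "nat list \<Rightarrow> nat \<Rightarrow> nat" where
  "tableau_row \<mu> i = (LEAST j. i \<le> sum_list (take (Suc j) \<mu>))"

definition tableau_col :: "nat list \<Rightarrow> nat \<Rightarrow> nat" where
  "tableau_col \<mu> i = i - sum_list (take (tableau_row \<mu> i) \<mu>)"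

definition row_group :: "nat list \<Rightarrow> (nat \<Rightarrow> nat) set" where
  "row_group \<mu> = {p \<in> carrier (sym_group (sum_list \<mu>)).
     \<forall>i\<in>{1..sum_list \<mu>}. tableau_row \<mu> (p i) = tableau_row \<mu> i}"

definition col_group :: "nat list \<Rightarrow> (nat \<Rightarrow> nat) set" where
  "col_group \<mu> = {q \<in> carrier (sym_group (sum_list \<mu>)).
     \<forall>i\<in>{1..sum_list \<mu>}. tableau_col \<mu> (q i) = tableau_col \<mu> i}"

text \<open>The Young symmetrizer \<open>(\<Sum>p. p) (\<Sum>q. sgn q \<cdot> q)\<close>, with \<open>p\<close> ranging over the row group and \<open>q\<close>
  over the column group, and the Specht module as the left ideal it generates.  With these
  conventions \<open>(m)\<close> gives the trivial and \<open>(1\<^sup>m)\<close> the sign representation.\<close>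

definition young_symmetrizer :: "nat list \<Rightarrow> (nat \<Rightarrow> nat) \<Rightarrow> complex" where
  "young_symmetrizer \<mu> = convolution (sym_group (sum_list \<mu>))
     (\<lambda>p. of_bool (p \<in> row_group \<mu>))
     (\<lambda>q. of_bool (q \<in> col_group \<mu>) * of_int (sign q))"

definition specht_module :: "nat list \<Rightarrow> ((nat \<Rightarrow> nat) \<Rightarrow> complex) set" where
  "specht_module \<mu> =
     (let G = sym_group (sum_list \<mu>)
      in (\<lambda>f. convolution G f (young_symmetrizer \<mu>)) ` group_algebra G)"

text \<open>Matrix form of the left action on the Specht module.  The choice of basis affects
  it only up to similarity.\<close>

definition specht_rep :: "nat list \<Rightarrow> (nat \<Rightarrow> nat) \<Rightarrow> complex mat" where
  "specht_rep \<mu> w =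
     (let bs = (SOME bs. is_ordered_basis (specht_module \<mu>) bs)
      in matrix_of bs (convolution (sym_group (sum_list \<mu>)) (delta w)))"

definition twisted_specht_rep :: "complex \<Rightarrow> nat \<Rightarrow> nat list \<Rightarrow> wreath_elem \<Rightarrow> complex mat" where
  "twisted_specht_rep \<zeta> k \<mu> g = zeta_char \<zeta> (sum_list \<mu>) g ^ k \<cdot>\<^sub>m specht_rep \<mu> (snd g)"


section \<open>External tensor products and induction\<close>

definition kronecker :: "complex mat \<Rightarrow> complex mat \<Rightarrow> complex mat" where
  "kronecker A B = mat (dim_row A * dim_row B) (dim_col A * dim_col B)
     (\<lambda>(i, j). A $$ (i div dim_row B, j div dim_col B) * B $$ (i mod dim_row B, j mod dim_col B))"

definition kronecker_list :: "complex mat list \<Rightarrow> complex mat" where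
  "kronecker_list As = foldr kronecker As (1\<^sub>m 1)"

definition left_transversal :: "('g, 'm) monoid_scheme \<Rightarrow> 'g set \<Rightarrow> 'g list \<Rightarrow> bool" where
  "left_transversal G H ts \<longleftrightarrow> distinct ts \<and> set ts \<subseteq> carrier G \<and>
     (\<forall>g\<in>carrier G. \<exists>!t. t \<in> set ts \<and> g \<in> t <#\<^bsub>G\<^esub> H)"

text \<open>The representation of \<open>G\<close> induced from a matrix representation \<open>R\<close> of the subgroup \<open>H\<close>: the block
  matrix whose block at \<open>(i, j)\<close> is \<open>R (t\<^sub>i\<inverse> g t\<^sub>j)\<close>, read as zero outside \<open>H\<close>.\<close>

definition induced_rep ::
  "('g, 'm) monoid_scheme \<Rightarrow> 'g set \<Rightarrow> ('g \<Rightarrow> complex mat) \<Rightarrow> 'g \<Rightarrow> complex mat" where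
  "induced_rep G H R g =
     (let ts = (SOME ts. left_transversal G H ts);
          d = dim_row (R \<one>\<^bsub>G\<^esub>)
      in mat (length ts * d) (length ts * d)
           (\<lambda>(i, j). let h = inv\<^bsub>G\<^esub> (ts ! (i div d)) \<otimes>\<^bsub>G\<^esub> g \<otimes>\<^bsub>G\<^esub> (ts ! (j div d))
                     in if h \<in> H then R h $$ (i mod d, j mod d) else 0))"


section \<open>The irreducible representations of \<open>G(n,r)\<close>\<close>

text \<open>For \<open>as = [a\<^sub>1, \<dots>, a\<^sub>r]\<close>, the subgroup \<open>G(a\<^sub>1,r) \<times> \<dots> \<times> G(a\<^sub>r,r)\<close> of \<open>G(n,r)\<close> consists of the
  elements whose permutation preserves each of the consecutive blocks of sizes \<open>a\<^sub>1, \<dots>, a\<^sub>r\<close>.  Its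
  \<open>k\<close>-th factor is obtained by restricting to the \<open>k\<close>-th block and renumbering it \<open>1, \<dots>, a\<^sub>k\<close>.\<close>

definition block_offset :: "nat list \<Rightarrow> nat \<Rightarrow> nat" where
  "block_offset as k = sum_list (take k as)"

definition block :: "nat list \<Rightarrow> nat \<Rightarrow> nat set" where
  "block as k = {block_offset as k + 1 .. block_offset as k + as ! k}"

definition block_subgroup :: "nat \<Rightarrow> nat \<Rightarrow> nat list \<Rightarrow> wreath_elem set" where
  "block_subgroup n r as =
     {g \<in> carrier (wreath n r). \<forall>k<length as. snd g ` block as k = block as k}"

definition block_component :: "nat list \<Rightarrow> nat \<Rightarrow> wreath_elem \<Rightarrow> wreath_elem" where
  "block_component as k = (\<lambda>(x, w).
     (\<lambda>i\<in>{1..as ! k}. x (block_offset as k + i),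
      \<lambda>i. if i \<in> {1..as ! k} then w (block_offset as k + i) - block_offset as k else i))"

definition wreath_irrep ::
  "complex \<Rightarrow> nat \<Rightarrow> nat \<Rightarrow> nat list list \<Rightarrow> wreath_elem \<Rightarrow> complex mat" where
  "wreath_irrep \<zeta> n r \<Lambda> =
     (let as = map sum_list \<Lambda>
      in induced_rep (wreath n r) (block_subgroup n r as)
           (\<lambda>h. kronecker_list
              (map (\<lambda>k. twisted_specht_rep \<zeta> k (\<Lambda> ! k) (block_component as k h)) [0..<r])))"

definition N_plus :: "complex \<Rightarrow> nat \<Rightarrow> nat \<Rightarrow> nat \<Rightarrow> nat" where
  "N_plus \<zeta> r s n = card {\<Lambda> \<in> multipartitions n r.
     \<forall>g\<in>carrier (wreath n r). det (wreath_irrep \<zeta> n r \<Lambda> g) = zeta_char \<zeta> n g ^ s}"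

text \<open>For \<open>n = 1\<close> the sign character is trivial, and every multipartition is already counted by \<open>N_plus\<close>;
  by convention nothing is counted here.\<close>

definition N_minus :: "complex \<Rightarrow> nat \<Rightarrow> nat \<Rightarrow> nat \<Rightarrow> nat" where
  "N_minus \<zeta> r s n = (if n = 1 then 0 else card {\<Lambda> \<in> multipartitions n r.
     \<forall>g\<in>carrier (wreath n r). det (wreath_irrep \<zeta> n r \<Lambda> g) = zeta_char \<zeta> n g ^ s * sgn_char g})"

end

theory Submission
  imports Defs "HOL-Number_Theory.Cong"
begin

text \<open>Rotating the components of a multipartition cyclically tensors the representation with \<open>\<zeta>\<close> or
  its inverse: if \<open>\<Lambda>'\<close> is \<open>\<Lambda>\<close> with its first component moved to the end, then
  \<open>\<rho>\<^sub>\<Lambda> \<cong> \<zeta> \<otimes> \<rho>\<^bsub>\<Lambda>'\<^esub>\<close>, and therefore \<open>det \<rho>\<^sub>\<Lambda> = \<zeta>\<^bsup>d\<^esup> det \<rho>\<^bsub>\<Lambda>'\<^esub>\<close> with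
  \<open>d\<close> the common dimension. This dimension is the index of the block subgroup, which divides \<open>n!\<close>,
  times the dimensions of the Specht modules, each of which divides the factorial of a number at most
  \<open>n\<close>. As \<open>n < r\<close> and \<open>r\<close> is prime, \<open>d\<close> is a unit mod \<open>r\<close>; a rotation by a number of steps that
  depends only on \<open>d\<close> thus maps the multipartitions with determinant \<open>\<zeta>\<^sup>s\<close> injectively to those with
  determinant \<open>\<zeta>\<^sup>t\<close>. A sign factor is carried along unchanged.\<close>

section \<open>Group algebras\<close>

text \<open>The component at index \<open>k\<close> carries the twist by \<open>\<zeta>\<close> to
  the power \<open>k\<close>. Splitting one copy of \<open>\<zeta>\<close> off every factor lowers
  each exponent by one, and the exponent 0 at the front becomes \<open>r - 1\<close>, which belongs
  to the last place; this is why the operation is a cyclic rotation. The obstacle is that the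
  definitions choose bases and transversals by \<open>SOME\<close>, and that rotating also changes
  the subgroup from which one induces. The Specht factors cause no mismatch, as their basis depends
  on the partition alone; the two induced matrices, however, have to be linked by an explicit change
  of coordinates. A Specht dimension divides the factorial for the following reason. The Young
  symmetrizer satisfies c * c = k c, and comparing two expressions for the trace of right
  multiplication by c gives k * dim = m!. That k is an integer turns this identity into a
  divisibility. Equality of the counts comes from inequalities: there is an injection for every
  ordered pair (s, t).\<close>

context group
begin

lemma mult_inv_cancel:
  assumes "a \<in> carrier G" "b \<in> carrier G"
  shows "a \<otimes> (inv a \<otimes> b) = b" and "inv a \<otimes> (a \<otimes> b) = b"
  using assms by (simp_all flip: m_assoc)

lemma sum_left_translate:
  assumes "a \<in> carrier G"
  shows "(\<Sum>h\<in>carrier G. F (a \<otimes> h)) = (\<Sum>h\<in>carrier G. F h)"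
  by (rule sum.reindex_bij_witness[of _ "\<lambda>h. inv a \<otimes> h" "\<lambda>h. a \<otimes> h"])
    (use assms in \<open>auto simp: m_assoc[symmetric]\<close>)

lemma convolution_in_group_algebra: "convolution G f f' \<in> group_algebra G"
  by (simp add: group_algebra_def convolution_def)

lemma convolution_assoc:
  "convolution G (convolution G f f') f'' = convolution G f (convolution G f' f'')"
proof
  fix g
  show "convolution G (convolution G f f') f'' g = convolution G f (convolution G f' f'') g"
  proof (cases "g \<in> carrier G")
    case g: True
    have "convolution G (convolution G f f') f'' g =
        (\<Sum>k\<in>carrier G. \<Sum>h\<in>carrier G. f k * f' (inv k \<otimes> h) * f'' (inv h \<otimes> g))"
      using g by (simp add: convolution_def sum_distrib_right, subst sum.swap) simp
    also have "\<dots> = (\<Sum>k\<in>carrier G. \<Sum>h\<in>carrier G. f k * f' h * f'' (inv h \<otimes> (inv k \<otimes> g)))"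
    proof (rule sum.cong)
      fix k assume k: "k \<in> carrier G"
      show "(\<Sum>h\<in>carrier G. f k * f' (inv k \<otimes> h) * f'' (inv h \<otimes> g)) =
          (\<Sum>h\<in>carrier G. f k * f' h * f'' (inv h \<otimes> (inv k \<otimes> g)))"
        by (subst sum_left_translate[OF k, symmetric])
          (use k g in \<open>auto intro!: sum.cong simp: m_assoc[symmetric] inv_mult_group\<close>)
    qed simp
    finally show ?thesis
      using g by (simp add: convolution_def sum_distrib_left mult.assoc)
  qed (simp add: convolution_def)
qed

text \<open>Left translation by \<open>w\<close>. The \<open>if\<close> stays because
  \<open>convolution\<close> cuts off outside the carrier, so \<open>delta \<one>\<close> acts as
  the identity only on \<open>group_algebra G\<close>.\<close>

lemma convolution_delta_left:
  assumes "finite (carrier G)" "w \<in> carrier G"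
  shows "convolution G (delta w) f = (\<lambda>g. if g \<in> carrier G then f (inv w \<otimes> g) else 0)"
  using assms by (auto simp: convolution_def delta_def fun_eq_iff of_bool_def if_distrib if_distribR
      cong: if_cong)

lemma convolution_delta_one:
  assumes "finite (carrier G)" "f \<in> group_algebra G"
  shows "convolution G (delta \<one>) f = f"
  using assms by (auto simp: convolution_delta_left group_algebra_def)

lemma convolution_delta_mult:
  assumes "finite (carrier G)" "v \<in> carrier G" "w \<in> carrier G"
  shows "convolution G (delta (v \<otimes> w)) f = convolution G (delta v) (convolution G (delta w) f)"
  using assms by (auto simp: convolution_delta_left inv_mult_group m_assoc fun_eq_iff)

lemma linear_convolution_left:
  "Vector_Spaces.linear (\<lambda>c f x. c * f x) (\<lambda>c f x. c * f x) (convolution G a)"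
  by unfold_locales (auto simp: fun_eq_iff convolution_def sum.distrib sum_distrib_left algebra_simps)

lemma linear_convolution_right:
  "Vector_Spaces.linear (\<lambda>c f x. c * f x) (\<lambda>c f x. c * f x) (\<lambda>f. convolution G f a)"
  by unfold_locales (auto simp: fun_eq_iff convolution_def sum.distrib sum_distrib_left algebra_simps)

lemma subspace_group_algebra: "cfun.subspace (group_algebra G)"
  by (auto simp: cfun.subspace_def group_algebra_def)

lemma subspace_left_ideal: "cfun.subspace ((\<lambda>f. convolution G f a) ` group_algebra G)"
proof -
  interpret L: Vector_Spaces.linear "\<lambda>c f x. c * f x" "\<lambda>c f x. c * f x" "\<lambda>f. convolution G f a"
    by (rule linear_convolution_right)
  show ?thesis
    by (rule L.subspace_image[OF subspace_group_algebra])
qed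

end

section \<open>Finite bases in the group algebra and matrices of linear maps\<close>

lemma sum_fun_apply: "(\<Sum>i\<in>A. F i) x = (\<Sum>i\<in>A. F i x)"
  for F :: "'i \<Rightarrow> 'a \<Rightarrow> 'b::comm_monoid_add"
  by (induction A rule: infinite_finite_induct) auto

lemma group_algebra_subset_span: 
  assumes "finite (carrier G)"
  shows "group_algebra G \<subseteq> cfun.span (delta ` carrier G)"
proof
  fix f assume f: "f \<in> group_algebra G"
  have "f = (\<Sum>g\<in>carrier G. (\<lambda>x. f g * delta g x))"
  proof
    fix x
    show "f x = (\<Sum>g\<in>carrier G. (\<lambda>x. f g * delta g x)) x"
      using f assms by (cases "x \<in> carrier G") (auto simp: sum_fun_apply delta_def group_algebra_def)
  qed
  moreover have "\<dots> \<in> cfun.span (delta ` carrier G)"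
    by (intro cfun.span_sum cfun.span_scale cfun.span_base) auto
  ultimately show "f \<in> cfun.span (delta ` carrier G)"
    by simp
qed

text \<open>Justifies the \<open>SOME\<close> in \<open>specht_rep\<close>. A maximal independent
  subset always exists; it is finite because it lies in the span of finitely many deltas.\<close>

lemma ex_ordered_basis:
  assumes "finite (carrier G)" "cfun.subspace V" "V \<subseteq> group_algebra G"
  shows "\<exists>bs. is_ordered_basis V bs"
proof -
  obtain B where B: "B \<subseteq> V" "cfun.independent B" "V \<subseteq> cfun.span B"
    using cfun.maximal_independent_subset by blast
  have "finite B"
    using cfun.independent_span_bound[of "delta ` carrier G" B] B assms group_algebra_subset_span[of G]
    by blast
  then obtain bs where "set bs = B" "distinct bs"
    using finite_distinct_list by blast
  then show ?thesis
    using B assms(2) cfun.span_minimal unfolding is_ordered_basis_def by blast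
qed

lemma matrix_of_cong:
  assumes "\<And>v. v \<in> set bs \<Longrightarrow> T v = U v"
  shows "matrix_of bs T = matrix_of bs U"
  by (rule eq_matI) (auto simp: matrix_of_def assms)

lemma matrix_of_id:
  assumes "is_ordered_basis V bs"
  shows "matrix_of bs (\<lambda>v. v) = 1\<^sub>m (length bs)"
  by (rule eq_matI)
    (use assms in \<open>auto simp: matrix_of_def is_ordered_basis_def cfun.representation_basis nth_eq_iff_index_eq\<close>)

text \<open>Expand \<open>U (bs ! j)\<close> in the basis and push the linear \<open>T\<close>
  through the sum: the coefficients are column \<open>j\<close> of the second matrix, the images of
  the basis vectors give the columns of the first.\<close>

lemma matrix_of_comp:
  assumes bs: "is_ordered_basis V bs"
    and T: "Vector_Spaces.linear (\<lambda>c f x. c * f x) (\<lambda>c f x. c * f x) T"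
    and TV: "\<And>v. v \<in> V \<Longrightarrow> T v \<in> V" and UV: "\<And>v. v \<in> V \<Longrightarrow> U v \<in> V"
  shows "matrix_of bs (\<lambda>v. T (U v)) = matrix_of bs T * matrix_of bs U"
proof (rule eq_matI)
  interpret T: Vector_Spaces.linear "\<lambda>c f x. c * f x" "\<lambda>c f x. c * f x" T
    by (rule T)
  fix i j
  assume "i < dim_row (matrix_of bs T * matrix_of bs U)"
    and "j < dim_col (matrix_of bs T * matrix_of bs U)"
  then have i: "i < length bs" and j: "j < length bs"
    by (auto simp: matrix_of_def)
  have ind: "cfun.independent (set bs)" and sp: "cfun.span (set bs) = V" and di: "distinct bs"
    using bs by (auto simp: is_ordered_basis_def)
  have bV: "b \<in> V" if "b \<in> set bs" for b
    using that sp cfun.span_base by blast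
  let ?\<phi> = "cfun.representation (set bs)"
  let ?u = "U (bs ! j)"
  have Tsp: "T b \<in> cfun.span (set bs)" if "b \<in> set bs" for b
    using that TV bV sp by blast
  have uV: "?u \<in> V"
    using j bV UV by simp
  have "?\<phi> (T ?u) (bs ! i) = ?\<phi> (T (\<Sum>b\<in>set bs. (\<lambda>x. ?\<phi> ?u b * b x))) (bs ! i)"
    using cfun.sum_representation_eq[OF ind, of ?u "set bs"] uV sp by simp
  also have "\<dots> = ?\<phi> (\<Sum>b\<in>set bs. (\<lambda>x. ?\<phi> ?u b * T b x)) (bs ! i)"
    by (simp add: T.sum T.scale)
  also have "\<dots> = (\<Sum>b\<in>set bs. ?\<phi> (\<lambda>x. ?\<phi> ?u b * T b x) (bs ! i))"
    by (subst cfun.representation_sum[OF ind]) (use cfun.span_scale[OF Tsp] in \<open>auto simp: sum_fun_apply\<close>)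
  also have "\<dots> = (\<Sum>b\<in>set bs. ?\<phi> ?u b * ?\<phi> (T b) (bs ! i))"
    by (intro sum.cong) (use sp TV bV cfun.representation_scale[OF ind] in \<open>auto\<close>)
  also have "\<dots> = (\<Sum>k<length bs. ?\<phi> ?u (bs ! k) * ?\<phi> (T (bs ! k)) (bs ! i))"
    by (rule sum.reindex_bij_betw[symmetric]) (simp add: bij_betw_nth[OF di])
  finally show "matrix_of bs (\<lambda>v. T (U v)) $$ (i, j) = (matrix_of bs T * matrix_of bs U) $$ (i, j)"
    using i j by (simp add: matrix_of_def scalar_prod_def atLeast0LessThan mult.commute)
qed (simp_all add: matrix_of_def)

text \<open>Both sides are the trace of right convolution with \<open>a\<close>, which maps onto the left ideal and
  acts on it as the scalar \<open>\<alpha>\<close>.\<close>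

lemma (in group) trace_quasi_idempotent:
  assumes fin: "finite (carrier G)"
    and bs: "is_ordered_basis ((\<lambda>f. convolution G f a) ` group_algebra G) bs"
    and aa: "convolution G a a = (\<lambda>x. \<alpha> * a x)"
  shows "\<alpha> * of_nat (length bs) = of_nat (card (carrier G)) * a \<one>"
proof -
  define V where "V = (\<lambda>f. convolution G f a) ` group_algebra G"
  interpret R: Vector_Spaces.linear "\<lambda>c f x. c * f x" "\<lambda>c f x. c * f x" "\<lambda>f. convolution G f a"
    by (rule linear_convolution_right)
  interpret L: Vector_Spaces.linear "\<lambda>c f x. c * f x" "\<lambda>c f x. c * f x" "convolution G f" for f
    by (rule linear_convolution_left)
  let ?\<phi> = "cfun.representation (set bs)"
  have ind: "cfun.independent (set bs)" and sp: "cfun.span (set bs) = V" and di: "distinct bs"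
    using bs by (auto simp: is_ordered_basis_def V_def)
  have bV: "b \<in> V" if "b \<in> set bs" for b
    using that sp cfun.span_base by blast
  have dV: "convolution G (delta g) a \<in> V" if "g \<in> carrier G" for g
    using that by (auto simp: V_def group_algebra_def delta_def)
  have scal: "convolution G v a = (\<lambda>x. \<alpha> * v x)" if "v \<in> V" for v
    using that by (auto simp: V_def convolution_assoc aa L.scale)
  have expand: "convolution G v a = (\<Sum>g\<in>carrier G. (\<lambda>x. v g * convolution G (delta g) a x))"
    for v
    by (auto simp: fun_eq_iff sum_fun_apply convolution_delta_left[OF fin] convolution_def[of _ v])
  \<comment> \<open>The trace over the whole group algebra in the basis of deltas: each diagonal
    entry equals \<open>a \<one>\<close>.\<close>
  have "of_nat (card (carrier G)) * a \<one> = (\<Sum>g\<in>carrier G. convolution G (delta g) a g)"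
    by (simp add: convolution_delta_left fin)
  also have "\<dots> = (\<Sum>g\<in>carrier G. \<Sum>b\<in>set bs. ?\<phi> (convolution G (delta g) a) b * b g)"
  proof (rule sum.cong)
    fix g assume "g \<in> carrier G"
    then have "(\<Sum>b\<in>set bs. (\<lambda>x. ?\<phi> (convolution G (delta g) a) b * b x)) = convolution G (delta g) a"
      by (intro cfun.sum_representation_eq[OF ind]) (use dV sp in auto)
    from fun_cong[OF this, of g]
    show "convolution G (delta g) a g = (\<Sum>b\<in>set bs. ?\<phi> (convolution G (delta g) a) b * b g)"
      by (simp add: sum_fun_apply)
  qed simp
  \<comment> \<open>Exchanging the sums is trace(AB) = trace(BA). The inner sum is now the
    \<open>b\<close>-coordinate of the right convolution of \<open>b\<close> with \<open>a\<close>,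
    a diagonal entry on the ideal.\<close>
  also have "\<dots> = (\<Sum>b\<in>set bs. \<Sum>g\<in>carrier G. b g * ?\<phi> (convolution G (delta g) a) b)"
    by (subst sum.swap) (simp add: mult.commute)
  also have "\<dots> = (\<Sum>b\<in>set bs. \<alpha>)"
  proof (rule sum.cong)
    fix b assume b: "b \<in> set bs"
    have "(\<Sum>g\<in>carrier G. b g * ?\<phi> (convolution G (delta g) a) b) =
        (\<Sum>g\<in>carrier G. ?\<phi> (\<lambda>x. b g * convolution G (delta g) a x) b)"
      by (intro sum.cong) (use sp dV cfun.representation_scale[OF ind] in auto)
    also have "\<dots> = ?\<phi> (convolution G b a) b"
      by (subst expand, subst cfun.representation_sum[OF ind])
        (use sp dV cfun.span_scale in \<open>auto simp: sum_fun_apply\<close>)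
    also have "\<dots> = \<alpha>"
      using cfun.representation_scale[OF ind, of b \<alpha>] cfun.representation_basis[OF ind b] bV[OF b] sp
      by (simp add: scal)
    finally show "(\<Sum>g\<in>carrier G. b g * ?\<phi> (convolution G (delta g) a) b) = \<alpha>" .
  qed simp
  finally show ?thesis
    using di by (simp add: distinct_card mult.commute)
qed

section \<open>Specht modules\<close>

lemma tableau_row_bounds:
  assumes "i \<in> {1..sum_list \<mu>}"
  shows "tableau_row \<mu> i < length \<mu>"
    and "sum_list (take (tableau_row \<mu> i) \<mu>) < i"
    and "i \<le> sum_list (take (Suc (tableau_row \<mu> i)) \<mu>)"
proof -
  let ?P = "\<lambda>j. i \<le> sum_list (take (Suc j) \<mu>)"
  let ?j = "tableau_row \<mu> i"
  have ne: "\<mu> \<noteq> []"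
    using assms by auto
  then have P: "?P (length \<mu> - 1)"
    using assms by simp
  then show Pj: "?P ?j"
    unfolding tableau_row_def by (rule LeastI)
  have "?j \<le> length \<mu> - 1"
    unfolding tableau_row_def using P by (rule Least_le)
  then show "?j < length \<mu>"
    using ne by (cases \<mu>) auto
  show "sum_list (take ?j \<mu>) < i"
  proof (cases ?j)
    case (Suc k)
    then have "\<not> ?P k"
      using not_less_Least[of k ?P] by (simp add: tableau_row_def)
    then show ?thesis
      using Suc by simp
  qed (use assms in simp)
qed

lemma tableau_position_inject:
  assumes "i \<in> {1..sum_list \<mu>}" "j \<in> {1..sum_list \<mu>}"
    and "tableau_row \<mu> i = tableau_row \<mu> j" "tableau_col \<mu> i = tableau_col \<mu> j"
  shows "i = j"
  using tableau_row_bounds(2)[OF assms(1)] tableau_row_bounds(2)[OF assms(2)] assms(3,4)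
  by (simp add: tableau_col_def)

lemma tableau_col_bounds:
  assumes "i \<in> {1..sum_list \<mu>}"
  shows "0 < tableau_col \<mu> i" "tableau_col \<mu> i \<le> \<mu> ! tableau_row \<mu> i"
  using tableau_row_bounds[OF assms] by (auto simp: tableau_col_def take_Suc_conv_app_nth)

lemma sum_list_take_mono: "j \<le> k \<Longrightarrow> sum_list (take j \<mu>) \<le> sum_list (take k (\<mu> :: nat list))"
  by (metis le_add1 le_add_diff_inverse sum_list_append take_add)

lemma tableau_position_surj:
  assumes "j < length \<mu>" "0 < c" "c \<le> \<mu> ! j"
  shows "\<exists>i\<in>{1..sum_list \<mu>}. tableau_row \<mu> i = j \<and> tableau_col \<mu> i = c"
proof
  \<comment> \<open>Columns are counted from 1, so the entry is the number of entries in the rows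
    above plus \<open>c\<close>, without a shift by one.\<close>
  let ?i = "sum_list (take j \<mu>) + c"
  have le: "?i \<le> sum_list (take (Suc j) \<mu>)"
    using assms by (simp add: take_Suc_conv_app_nth)
  also have "\<dots> \<le> sum_list (take (length \<mu>) \<mu>)"
    by (rule sum_list_take_mono) (use assms in simp)
  finally show "?i \<in> {1..sum_list \<mu>}"
    using assms by simp
  have "tableau_row \<mu> ?i = j"
    unfolding tableau_row_def
  proof (rule Least_equality[where P = "\<lambda>j. _ \<le> sum_list (take (Suc j) \<mu>)", OF le])
    fix k assume "?i \<le> sum_list (take (Suc k) \<mu>)"
    then show "j \<le> k"
      using sum_list_take_mono[of "Suc k" j \<mu>] assms(2) by (cases "j \<le> k") auto
  qed
  then show "tableau_row \<mu> ?i = j \<and> tableau_col \<mu> ?i = c"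
    by (simp add: tableau_col_def)
qed

lemma downward_closed_eq_lessThan:
  fixes S :: "nat set"
  assumes "finite S" "\<And>x y. x \<in> S \<Longrightarrow> y < x \<Longrightarrow> y \<in> S"
  shows "S = {..<card S}"
proof (rule card_subset_eq)
  show "S \<subseteq> {..<card S}"
  proof
    fix x assume "x \<in> S"
    then have "{..x} \<subseteq> S"
      using assms(2) by (auto simp: le_less)
    then have "card {..x} \<le> card S"
      by (rule card_mono[OF assms(1)])
    then show "x \<in> {..<card S}"
      by simp
  qed
qed simp_all

text \<open>Among sets of a given size the initial segment has the least sum. The extra summand
  counts the elements outside the segment, so that equality of the two sums forces \<open>S\<close>
  to be the segment itself.\<close>

lemma sum_lessThan_card_le:
  fixes S :: "nat set"
  assumes "finite S"
  shows "\<Sum>{..<card S} + card (S - {..<card S}) \<le> \<Sum>S"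
proof -
  let ?I = "{..<card S}"
  have "card (S - ?I) + card (S \<inter> ?I) = card (?I - S) + card (S \<inter> ?I)"
    using card_Int_Diff[OF assms, of ?I] card_Int_Diff[of ?I S] by (simp add: Int_commute)
  then have c: "card (S - ?I) = card (?I - S)"
    by simp
  \<comment> \<open>An element missing from the segment is at most \<open>card S - 1\<close>, a
    surplus element of \<open>S\<close> is at least \<open>card S\<close>, and there are equally
    many of both.\<close>
  have "\<Sum>(?I - S) + card (?I - S) = (\<Sum>x\<in>?I - S. x + 1)"
    by (simp only: sum.distrib) simp
  also have "\<dots> \<le> card (?I - S) * card S"
    using sum_bounded_above[of "?I - S" "\<lambda>x. x + 1" "card S"] by auto
  also have "\<dots> \<le> \<Sum>(S - ?I)"
    using sum_bounded_below[of "S - ?I" "card S" "\<lambda>x. x"] c by auto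
  finally have "\<Sum>(?I - S) + card (S - ?I) \<le> \<Sum>(S - ?I)"
    using c by simp
  moreover have "\<Sum>S = \<Sum>(S \<inter> ?I) + \<Sum>(S - ?I)"
    by (rule sum.Int_Diff[OF assms])
  moreover have "\<Sum>?I = \<Sum>(S \<inter> ?I) + \<Sum>(?I - S)"
    by (subst sum.Int_Diff[of ?I _ S]) (simp_all add: Int_commute)
  ultimately show ?thesis
    by linarith
qed

text \<open>A column that reaches row \<open>x\<close> meets every row above it, because the row
  lengths decrease weakly, and distinct entries of one column lie in distinct rows. This is where
  the shape has to be a partition.\<close>

lemma rows_of_column:
  assumes "is_partition \<mu>"
  shows "tableau_row \<mu> ` {i \<in> {1..sum_list \<mu>}. tableau_col \<mu> i = c} =
    {..<card {i \<in> {1..sum_list \<mu>}. tableau_col \<mu> i = c}}"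
proof -
  let ?C = "{i \<in> {1..sum_list \<mu>}. tableau_col \<mu> i = c}"
  have "tableau_row \<mu> ` ?C = {..<card (tableau_row \<mu> ` ?C)}"
  proof (rule downward_closed_eq_lessThan)
    fix x y assume "x \<in> tableau_row \<mu> ` ?C" and y: "y < x"
    then obtain i where i: "i \<in> {1..sum_list \<mu>}" "tableau_col \<mu> i = c" "tableau_row \<mu> i = x"
      by auto
    have "x < length \<mu>"
      using tableau_row_bounds(1)[OF i(1)] i(3) by simp
    moreover from this have "\<mu> ! x \<le> \<mu> ! y"
      using assms y by (simp add: is_partition_def sorted_wrt_iff_nth_less)
    ultimately show "y \<in> tableau_row \<mu> ` ?C"
      using tableau_position_surj[of y \<mu> c] tableau_col_bounds[OF i(1)] i y by force
  qed simp
  moreover have "inj_on (tableau_row \<mu>) ?C"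
    using tableau_position_inject by (intro inj_onI) auto
  ultimately show ?thesis
    by (simp add: card_image)
qed

text \<open>The row group and the column group are the cases \<open>f = tableau_row \<mu>\<close>
  and \<open>f = tableau_col \<mu>\<close>.\<close>

lemma subgroup_sym_group_invariant:
  "subgroup {p \<in> carrier (sym_group m). \<forall>i\<in>{1..m}. f (p i) = f i} (sym_group m)"
proof -
  interpret group "sym_group m"
    by (rule sym_group_is_group)
  show ?thesis
  proof (rule subgroupI)
    fix p assume "p \<in> {p \<in> carrier (sym_group m). \<forall>i\<in>{1..m}. f (p i) = f i}"
    then have p: "p permutes {1..m}" "\<And>i. i \<in> {1..m} \<Longrightarrow> f (p i) = f i"
      by (auto simp: sym_group_carrier)
    have "f (inv' p i) = f i" if "i \<in> {1..m}" for i
    proof -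
      have "inv' p i \<in> {1..m}"
        using permutes_in_image[OF permutes_inv[OF p(1)]] that by blast
      then show ?thesis
        using p(2)[of "inv' p i"] permutes_inverses(1)[OF p(1)] by simp
    qed
    then show "inv\<^bsub>sym_group m\<^esub> p \<in> {p \<in> carrier (sym_group m). \<forall>i\<in>{1..m}. f (p i) = f i}"
      using p(1) by (simp add: sym_group_carrier permutes_inv)
  next
    fix p q assume "p \<in> {p \<in> carrier (sym_group m). \<forall>i\<in>{1..m}. f (p i) = f i}"
      and "q \<in> {p \<in> carrier (sym_group m). \<forall>i\<in>{1..m}. f (p i) = f i}"
    then have pq: "p permutes {1..m}" "q permutes {1..m}"
      "\<And>i. i \<in> {1..m} \<Longrightarrow> f (p i) = f i" "\<And>i. i \<in> {1..m} \<Longrightarrow> f (q i) = f i"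
      by (auto simp: sym_group_carrier)
    then show "p \<otimes>\<^bsub>sym_group m\<^esub> q \<in> {p \<in> carrier (sym_group m). \<forall>i\<in>{1..m}. f (p i) = f i}"
      using permutes_in_image[OF pq(2)] by (simp add: sym_group_mult sym_group_carrier permutes_compose)
  next
    have "id \<in> {p \<in> carrier (sym_group m). \<forall>i\<in>{1..m}. f (p i) = f i}"
      by (simp add: sym_group_carrier permutes_id)
    then show "{p \<in> carrier (sym_group m). \<forall>i\<in>{1..m}. f (p i) = f i} \<noteq> {}"
      by blast
  qed auto
qed

lemma subgroup_row_group: "subgroup (row_group \<mu>) (sym_group (sum_list \<mu>))"
  unfolding row_group_def by (rule subgroup_sym_group_invariant)

lemma subgroup_col_group: "subgroup (col_group \<mu>) (sym_group (sum_list \<mu>))"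
  unfolding col_group_def by (rule subgroup_sym_group_invariant)

lemma row_col_group_disjoint:
  assumes "p \<in> row_group \<mu>" "p \<in> col_group \<mu>"
  shows "p = id"
proof
  fix i
  have p: "p permutes {1..sum_list \<mu>}"
    using assms by (simp add: row_group_def sym_group_carrier)
  show "p i = id i"
  proof (cases "i \<in> {1..sum_list \<mu>}")
    case True
    then show ?thesis
      using assms permutes_in_image[OF p] tableau_position_inject[of "p i" \<mu> i]
      by (auto simp: row_group_def col_group_def)
  qed (use p in \<open>auto simp: permutes_def\<close>)
qed

text \<open>A column of height \<open>h\<close> meets \<open>h\<close> distinct rows of the permuted tableau, whose indices add up
  to at least \<open>0 + \<dots> + (h - 1)\<close>. Over all columns these bounds add up to the sum of all row indices,
  which a permutation does not change; so each column meets precisely the rows \<open>0, \<dots>, h - 1\<close>.\<close>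

lemma row_col_factorization:
  assumes \<mu>: "is_partition \<mu>" and g: "g permutes {1..sum_list \<mu>}"
    and sep: "\<And>i j. i \<in> {1..sum_list \<mu>} \<Longrightarrow> j \<in> {1..sum_list \<mu>} \<Longrightarrow>
      tableau_col \<mu> i = tableau_col \<mu> j \<Longrightarrow> tableau_row \<mu> (g i) = tableau_row \<mu> (g j) \<Longrightarrow> i = j"
  shows "\<exists>p\<in>row_group \<mu>. \<exists>q\<in>col_group \<mu>. g = p \<circ> q"
proof -
  let ?m = "sum_list \<mu>"
  let ?row = "tableau_row \<mu>" and ?col = "tableau_col \<mu>"
  define C where "C c = {i \<in> {1..?m}. ?col i = c}" for c
  define S where "S c = (\<lambda>i. ?row (g i)) ` C c" for c
  have injg: "inj_on (\<lambda>i. ?row (g i)) (C c)" and injr: "inj_on ?row (C c)" for c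
    using sep tableau_position_inject by (auto simp: C_def intro!: inj_onI)
  have cardS: "card (S c) = card (C c)" and finS: "finite (S c)" for c
    using injg by (auto simp: S_def card_image C_def)
  have rows: "?row ` C c = {..<card (C c)}" for c
    using rows_of_column[OF \<mu>] by (simp add: C_def)
  have cols: "(\<Sum>i\<in>{1..?m}. h i) = (\<Sum>c\<in>?col ` {1..?m}. \<Sum>i\<in>C c. h i)" for h :: "nat \<Rightarrow> nat"
    unfolding C_def by (rule sum.image_gen) simp
  have "(\<Sum>c\<in>?col ` {1..?m}. \<Sum>(S c)) = (\<Sum>i\<in>{1..?m}. ?row (g i))"
    unfolding cols by (simp add: S_def sum.reindex[OF injg])
  also have "\<dots> = (\<Sum>i\<in>{1..?m}. ?row i)"
    using sum.permute[OF g, of ?row] by (simp add: comp_def)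
  also have "\<dots> = (\<Sum>c\<in>?col ` {1..?m}. \<Sum>{..<card (C c)})"
    unfolding cols rows[symmetric] by (simp add: sum.reindex[OF injr])
  finally have total: "(\<Sum>c\<in>?col ` {1..?m}. \<Sum>{..<card (S c)}) = (\<Sum>c\<in>?col ` {1..?m}. \<Sum>(S c))"
    by (simp add: cardS)
  have S_eq: "S c = {..<card (C c)}" if "c \<in> ?col ` {1..?m}" for c
  proof -
    have "\<Sum>{..<card (S c)} \<le> \<Sum>(S c)" for c
      using sum_lessThan_card_le[OF finS, of c] by linarith
    \<comment> \<open>The inequality holds in each column and the totals agree, so it is an equality
      in every column.\<close>
    then have "\<Sum>{..<card (S c)} = \<Sum>(S c)"
      by (intro sum_mono_inv[OF total]) (use that in auto)
    then have "card (S c - {..<card (S c)}) = 0"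
      using sum_lessThan_card_le[OF finS, of c] by simp
    then have "S c \<subseteq> {..<card (S c)}"
      using finS by (simp add: Diff_eq_empty_iff)
    then show ?thesis
      using card_subset_eq[of "{..<card (S c)}" "S c"] by (simp add: cardS)
  qed
  \<comment> \<open>The entry to be put in the place of \<open>i\<close>: it comes from the same
    column, and \<open>g\<close> sends it to the row of \<open>i\<close>. The resulting
    \<open>q\<close> permutes within columns and \<open>g \<circ> q\<close> within rows, so the
    column factor of \<open>g\<close> is the inverse of \<open>q\<close>.\<close>
  have "\<exists>k\<in>C (?col i). ?row (g k) = ?row i" if "i \<in> {1..?m}" for i
  proof -
    have "?row i \<in> ?row ` C (?col i)"
      using that by (auto simp: C_def)
    also have "\<dots> = S (?col i)"
      using rows S_eq that by simp
    finally show ?thesis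
      by (auto simp: S_def)
  qed
  then obtain k where k: "\<And>i. i \<in> {1..?m} \<Longrightarrow> k i \<in> C (?col i)"
    "\<And>i. i \<in> {1..?m} \<Longrightarrow> ?row (g (k i)) = ?row i"
    by metis
  define q where "q i = (if i \<in> {1..?m} then k i else i)" for i
  have "inj_on q {1..?m}"
  proof (rule inj_onI)
    fix i j assume ij: "i \<in> {1..?m}" "j \<in> {1..?m}" "q i = q j"
    then have "k i = k j"
      by (simp add: q_def)
    have "?row i = ?row j"
      using k(2)[OF ij(1)] k(2)[OF ij(2)] \<open>k i = k j\<close> by simp
    moreover have "?col i = ?col j"
      using k(1)[OF ij(1)] k(1)[OF ij(2)] \<open>k i = k j\<close> unfolding C_def by simp
    ultimately show "i = j"
      by (rule tableau_position_inject[OF ij(1,2)])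
  qed
  moreover have "q ` {1..?m} \<subseteq> {1..?m}"
    using k(1) by (auto simp: q_def C_def)
  ultimately have "bij_betw q {1..?m} {1..?m}"
    by (simp add: bij_betw_def endo_inj_surj)
  then have q: "q permutes {1..?m}"
    by (rule bij_imp_permutes) (metis q_def)
  have qC: "q \<in> col_group \<mu>"
    using q k(1) by (auto simp: col_group_def sym_group_carrier q_def C_def)
  then have "inv' q \<in> col_group \<mu>"
    using subgroup.m_inv_closed[OF subgroup_col_group qC] q by (simp add: sym_group_carrier)
  moreover have "g \<circ> q \<in> row_group \<mu>"
    using q g k(2) by (simp add: row_group_def sym_group_carrier permutes_compose) (simp add: q_def)
  moreover have "g = (g \<circ> q) \<circ> inv' q"
    using permutes_inv_o(1)[OF q] by (simp add: comp_assoc)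
  ultimately show ?thesis
    by blast
qed

section \<open>The Young symmetrizer and its square\<close>

lemma finite_carrier_sym_group: "finite (carrier (sym_group m))"
  by (simp add: sym_group_def finite_permutations)

lemma card_carrier_sym_group: "card (carrier (sym_group m)) = fact m"
  by (simp add: sym_group_def card_permutations)

lemma sign_sym_group_mult:
  "p \<in> carrier (sym_group m) \<Longrightarrow> q \<in> carrier (sym_group m) \<Longrightarrow> sign (p \<circ> q) = sign p * sign q"
  by (rule sign_compose) (auto simp: sym_group_carrier permutation_permutes)

definition row_sum :: "nat list \<Rightarrow> (nat \<Rightarrow> nat) \<Rightarrow> complex" where
  "row_sum \<mu> = (\<lambda>p. of_bool (p \<in> row_group \<mu>))"

definition signed_col_sum :: "nat list \<Rightarrow> (nat \<Rightarrow> nat) \<Rightarrow> complex" where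
  "signed_col_sum \<mu> = (\<lambda>q. of_bool (q \<in> col_group \<mu>) * of_int (sign q))"

lemma young_symmetrizer_eq:
  "young_symmetrizer \<mu> = convolution (sym_group (sum_list \<mu>)) (row_sum \<mu>) (signed_col_sum \<mu>)"
  by (simp add: young_symmetrizer_def row_sum_def signed_col_sum_def)

text \<open>Replacing the summation variable \<open>h\<close> by \<open>p h\<close> moves
  \<open>p\<close> into the indicator of the row group, which absorbs it.\<close>

lemma convolution_row_sum:
  assumes p: "p \<in> row_group \<mu>" and g: "g \<in> carrier (sym_group (sum_list \<mu>))"
  shows "convolution (sym_group (sum_list \<mu>)) (row_sum \<mu>) f (p \<circ> g) =
    convolution (sym_group (sum_list \<mu>)) (row_sum \<mu>) f g"
proof -
  let ?G = "sym_group (sum_list \<mu>)"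
  interpret G: group ?G
    by (rule sym_group_is_group)
  have pG: "p \<in> carrier ?G"
    using p by (simp add: row_group_def)
  have R: "p \<otimes>\<^bsub>?G\<^esub> h \<in> row_group \<mu> \<longleftrightarrow> h \<in> row_group \<mu>" if "h \<in> carrier ?G" for h
    using subgroup.m_closed[OF subgroup_row_group p, of h] that
      subgroup.m_closed[OF subgroup_row_group subgroup.m_inv_closed[OF subgroup_row_group p], of "p \<otimes>\<^bsub>?G\<^esub> h"] pG
    by (auto simp del: sym_group_inv_equality simp flip: G.m_assoc)
  have "(\<Sum>h\<in>carrier ?G. row_sum \<mu> h * f (inv\<^bsub>?G\<^esub> h \<otimes>\<^bsub>?G\<^esub> (p \<otimes>\<^bsub>?G\<^esub> g))) =
      (\<Sum>h\<in>carrier ?G. row_sum \<mu> h * f (inv\<^bsub>?G\<^esub> h \<otimes>\<^bsub>?G\<^esub> g))"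
    by (subst G.sum_left_translate[OF pG, symmetric], intro sum.cong)
      (use pG g in \<open>simp_all add: row_sum_def R G.inv_mult_group G.m_assoc G.mult_inv_cancel
        del: sym_group_inv_equality\<close>)
  then show ?thesis
    using G.m_closed[OF pG g] g by (simp add: convolution_def sym_group_mult)
qed

text \<open>Mirror image of the row case: right translation by \<open>q\<close> preserves the column
  group, and the sign is multiplicative.\<close>

lemma convolution_signed_col_sum:
  assumes q: "q \<in> col_group \<mu>" and g: "g \<in> carrier (sym_group (sum_list \<mu>))"
  shows "convolution (sym_group (sum_list \<mu>)) f (signed_col_sum \<mu>) (g \<circ> q) =
    of_int (sign q) * convolution (sym_group (sum_list \<mu>)) f (signed_col_sum \<mu>) g"
proof -
  let ?G = "sym_group (sum_list \<mu>)"
  interpret G: group ?G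
    by (rule sym_group_is_group)
  have qG: "q \<in> carrier ?G"
    using q by (simp add: col_group_def)
  have C: "h \<otimes>\<^bsub>?G\<^esub> q \<in> col_group \<mu> \<longleftrightarrow> h \<in> col_group \<mu>" if "h \<in> carrier ?G" for h
    using subgroup.m_closed[OF subgroup_col_group _ q, of h] that
      subgroup.m_closed[OF subgroup_col_group _ subgroup.m_inv_closed[OF subgroup_col_group q], of "h \<otimes>\<^bsub>?G\<^esub> q"] qG
    by (auto simp: G.m_assoc simp del: sym_group_inv_equality)
  have b: "signed_col_sum \<mu> (h \<otimes>\<^bsub>?G\<^esub> q) = of_int (sign q) * signed_col_sum \<mu> h" if "h \<in> carrier ?G" for h
    using C[OF that] sign_sym_group_mult[OF that qG] by (simp add: signed_col_sum_def sym_group_mult)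
  have "(\<Sum>h\<in>carrier ?G. f h * signed_col_sum \<mu> (inv\<^bsub>?G\<^esub> h \<otimes>\<^bsub>?G\<^esub> (g \<otimes>\<^bsub>?G\<^esub> q))) =
      of_int (sign q) * (\<Sum>h\<in>carrier ?G. f h * signed_col_sum \<mu> (inv\<^bsub>?G\<^esub> h \<otimes>\<^bsub>?G\<^esub> g))"
    unfolding sum_distrib_left
    by (intro sum.cong) (use qG g b in \<open>simp_all del: sym_group_inv_equality flip: G.m_assoc\<close>)
  then show ?thesis
    using G.m_closed[OF g qG] g by (simp add: convolution_def sym_group_mult)
qed

text \<open>At \<open>id\<close> only elements of the row group whose inverse lies in the column
  group contribute. There \<open>id\<close> is the only one, so the value is 1; invariance on the
  left and the sign rule on the right carry it to \<open>p \<circ> q\<close>.\<close>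

lemma young_symmetrizer_row_col:
  assumes p: "p \<in> row_group \<mu>" and q: "q \<in> col_group \<mu>"
  shows "young_symmetrizer \<mu> (p \<circ> q) = of_int (sign q)"
proof -
  let ?G = "sym_group (sum_list \<mu>)"
  interpret G: group ?G
    by (rule sym_group_is_group)
  have one: "\<one>\<^bsub>?G\<^esub> = id"
    by (rule sym_group_one)
  have pG: "p \<in> carrier ?G" and qG: "q \<in> carrier ?G"
    using p q by (auto simp: row_group_def col_group_def)
  have "young_symmetrizer \<mu> id = (\<Sum>h\<in>carrier ?G. row_sum \<mu> h * signed_col_sum \<mu> (inv\<^bsub>?G\<^esub> h))"
    unfolding young_symmetrizer_eq convolution_def using G.one_closed
    by (simp add: one[symmetric] del: sym_group_inv_equality)
  also have "\<dots> = (\<Sum>h\<in>{id}. row_sum \<mu> h * signed_col_sum \<mu> (inv\<^bsub>?G\<^esub> h))"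
  proof (rule sum.mono_neutral_right)
    show "\<forall>h\<in>carrier ?G - {id}. row_sum \<mu> h * signed_col_sum \<mu> (inv\<^bsub>?G\<^esub> h) = 0"
    proof
      fix h assume h: "h \<in> carrier ?G - {id}"
      have "inv\<^bsub>?G\<^esub> h \<notin> col_group \<mu>" if "h \<in> row_group \<mu>"
        using subgroup.m_inv_closed[OF subgroup_col_group, of "inv\<^bsub>?G\<^esub> h"] row_col_group_disjoint[OF that] h
          G.inv_inv[of h] by force
      then show "row_sum \<mu> h * signed_col_sum \<mu> (inv\<^bsub>?G\<^esub> h) = 0"
        by (auto simp: row_sum_def signed_col_sum_def)
    qed
    show "{id} \<subseteq> carrier ?G"
      using G.one_closed one by simp
  qed (rule finite_carrier_sym_group)
  also have "\<dots> = 1"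
    using subgroup.one_closed[OF subgroup_row_group, of \<mu>] subgroup.one_closed[OF subgroup_col_group, of \<mu>]
      G.inv_one by (simp add: one row_sum_def signed_col_sum_def sign_id del: sym_group_inv_equality)
  finally have "young_symmetrizer \<mu> id = 1" .
  moreover have "young_symmetrizer \<mu> (p \<circ> (id \<circ> q)) = of_int (sign q) * young_symmetrizer \<mu> id"
    using convolution_row_sum[OF p, of "id \<circ> q"] convolution_signed_col_sum[OF q, of id] qG G.one_closed
    by (simp add: young_symmetrizer_eq one)
  ultimately show ?thesis
    by simp
qed

text \<open>A function that is invariant under the row group on the left and changes by
  \<open>sign\<close> under the column group on the right is a multiple of the Young symmetrizer: on
  products \<open>p \<circ> q\<close> it is determined by its value at \<open>id\<close>, elsewhere
  it vanishes. The square is such a function.\<close>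

lemma young_symmetrizer_quasi_idempotent:
  assumes \<mu>: "is_partition \<mu>"
  shows "\<exists>k::int. convolution (sym_group (sum_list \<mu>)) (young_symmetrizer \<mu>) (young_symmetrizer \<mu>) =
    (\<lambda>g. of_int k * young_symmetrizer \<mu> g)"
proof -
  let ?G = "sym_group (sum_list \<mu>)"
  interpret G: group ?G
    by (rule sym_group_is_group)
  define c where "c = young_symmetrizer \<mu>"
  define x where "x = convolution ?G c c"
  have conv_Ints: "convolution ?G f f' g \<in> \<int>" if "\<And>h. f h \<in> \<int>" "\<And>h. f' h \<in> \<int>" for f f' g
    using that by (auto simp: convolution_def intro!: Ints_sum)
  have "c g \<in> \<int>" for g
    unfolding c_def young_symmetrizer_eq
    by (rule conv_Ints) (auto simp: row_sum_def signed_col_sum_def)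
  \<comment> \<open>All coefficients are integers, hence so is the factor \<open>x id\<close>; the
    divisibility of the factorial rests on this.\<close>
  then have ints: "x g \<in> \<int>" for g
    unfolding x_def by (intro conv_Ints)
  have left: "x (p \<circ> g) = x g" "c (p \<circ> g) = c g" if "p \<in> row_group \<mu>" "g \<in> carrier ?G" for p g
    using convolution_row_sum[OF that]
    by (simp_all add: x_def c_def young_symmetrizer_eq G.convolution_assoc)
  have right: "x (g \<circ> q) = of_int (sign q) * x g" "c (g \<circ> q) = of_int (sign q) * c g"
    if "q \<in> col_group \<mu>" "g \<in> carrier ?G" for q g
    using convolution_signed_col_sum[OF that]
    by (simp_all add: x_def c_def young_symmetrizer_eq flip: G.convolution_assoc)
  have one: "\<one>\<^bsub>?G\<^esub> = id"
    by (rule sym_group_one)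
  \<comment> \<open>Moving \<open>g\<close> past a transposition within a column gives a
    transposition within a row. The former changes the sign of the value, the latter changes
    nothing, so the value is its own negative.\<close>
  have vanish: "x g = 0 \<and> c g = 0"
    if g: "g permutes {1..sum_list \<mu>}" and ij: "i \<in> {1..sum_list \<mu>}" "j \<in> {1..sum_list \<mu>}" "i \<noteq> j"
      and col: "tableau_col \<mu> i = tableau_col \<mu> j" and row: "tableau_row \<mu> (g i) = tableau_row \<mu> (g j)"
    for g i j
  proof -
    have gij: "g i \<in> {1..sum_list \<mu>}" "g j \<in> {1..sum_list \<mu>}" "g i \<noteq> g j"
      using g ij permutes_in_image[OF g] permutes_inj[OF g] by (auto dest: injD)
    have t: "transpose i j \<in> col_group \<mu>"
      using ij col by (auto simp: col_group_def sym_group_carrier permutes_swap_id transpose_def)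
    have t': "transpose (g i) (g j) \<in> row_group \<mu>"
      using gij row by (auto simp: row_group_def sym_group_carrier permutes_swap_id transpose_def)
    have "g \<circ> transpose i j = transpose (g i) (g j) \<circ> g"
      using g by (auto simp: fun_eq_iff transpose_def dest: permutes_inj injD)
    moreover have "sign (transpose i j) = -1"
      using ij by (simp add: sign_swap_id)
    ultimately show ?thesis
      using left[OF t', of g] right[OF t, of g] g by (simp add: sym_group_carrier)
  qed
  have "x g = x id * c g" for g
  proof (cases "g \<in> carrier ?G")
    case True
    then have g: "g permutes {1..sum_list \<mu>}"
      by (simp add: sym_group_carrier)
    show ?thesis
    proof (cases "\<exists>p\<in>row_group \<mu>. \<exists>q\<in>col_group \<mu>. g = p \<circ> q")
      case True
      then obtain p q where pq: "p \<in> row_group \<mu>" "q \<in> col_group \<mu>" "g = p \<circ> q"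
        by blast
      have "q \<in> carrier ?G"
        using pq by (simp add: col_group_def)
      then show ?thesis
        using pq left(1)[of p q] right(1)[of q id] young_symmetrizer_row_col[of p \<mu> q] G.one_closed
        by (simp add: one c_def)
    next
      case False
      then obtain i j where "i \<in> {1..sum_list \<mu>}" "j \<in> {1..sum_list \<mu>}" "i \<noteq> j"
        "tableau_col \<mu> i = tableau_col \<mu> j" "tableau_row \<mu> (g i) = tableau_row \<mu> (g j)"
        using row_col_factorization[OF \<mu> g] by metis
      from vanish[OF g this] show ?thesis
        by simp
    qed
  next
    case False
    then show ?thesis
      by (simp add: x_def c_def young_symmetrizer_eq convolution_def)
  qed
  moreover obtain k where "x id = of_int k"
    using ints Ints_cases by blast
  ultimately show ?thesis
    unfolding x_def c_def by auto
qed

section \<open>The Specht representation and its dimension\<close>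

definition specht_basis :: "nat list \<Rightarrow> ((nat \<Rightarrow> nat) \<Rightarrow> complex) list" where
  "specht_basis \<mu> = (SOME bs. is_ordered_basis (specht_module \<mu>) bs)"

abbreviation "specht_dim \<mu> \<equiv> length (specht_basis \<mu>)"

lemma is_ordered_basis_specht_basis: "is_ordered_basis (specht_module \<mu>) (specht_basis \<mu>)"
proof -
  interpret group "sym_group (sum_list \<mu>)"
    by (rule sym_group_is_group)
  show ?thesis
    unfolding specht_basis_def specht_module_def Let_def
    by (rule someI_ex, rule ex_ordered_basis[OF finite_carrier_sym_group subspace_left_ideal])
      (use convolution_in_group_algebra in blast)
qed

lemma specht_rep_eq:
  "specht_rep \<mu> w = matrix_of (specht_basis \<mu>) (convolution (sym_group (sum_list \<mu>)) (delta w))"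
  by (simp add: specht_rep_def specht_basis_def)

lemma specht_rep_carrier: "specht_rep \<mu> w \<in> carrier_mat (specht_dim \<mu>) (specht_dim \<mu>)"
  by (simp add: specht_rep_eq matrix_of_def)

lemma specht_module_subset: "specht_module \<mu> \<subseteq> group_algebra (sym_group (sum_list \<mu>))"
  using group.convolution_in_group_algebra[OF sym_group_is_group]
  by (auto simp: specht_module_def Let_def)

lemma specht_basis_subset: "set (specht_basis \<mu>) \<subseteq> specht_module \<mu>"
  using is_ordered_basis_specht_basis[of \<mu>] cfun.span_superset unfolding is_ordered_basis_def by blast

lemma specht_rep_id: "specht_rep \<mu> id = 1\<^sub>m (specht_dim \<mu>)"
proof -
  interpret group "sym_group (sum_list \<mu>)"
    by (rule sym_group_is_group)
  have "specht_rep \<mu> id = matrix_of (specht_basis \<mu>) (\<lambda>v. v)"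
    unfolding specht_rep_eq
  proof (rule matrix_of_cong)
    fix v assume "v \<in> set (specht_basis \<mu>)"
    then have "v \<in> group_algebra (sym_group (sum_list \<mu>))"
      using specht_basis_subset specht_module_subset by blast
    then show "convolution (sym_group (sum_list \<mu>)) (delta id) v = v"
      using convolution_delta_one[OF finite_carrier_sym_group] by (simp add: sym_group_one)
  qed
  then show ?thesis
    using matrix_of_id[OF is_ordered_basis_specht_basis] by simp
qed

lemma specht_rep_mult:
  assumes "v permutes {1..sum_list \<mu>}" "w permutes {1..sum_list \<mu>}"
  shows "specht_rep \<mu> (v \<circ> w) = specht_rep \<mu> v * specht_rep \<mu> w"
proof -
  let ?G = "sym_group (sum_list \<mu>)"
  interpret group ?G
    by (rule sym_group_is_group)
  have inv: "convolution ?G f x \<in> specht_module \<mu>" if x: "x \<in> specht_module \<mu>" for f x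
  proof -
    obtain y where "x = convolution ?G y (young_symmetrizer \<mu>)"
      using x by (auto simp: specht_module_def Let_def)
    then have "convolution ?G f x = convolution ?G (convolution ?G f y) (young_symmetrizer \<mu>)"
      by (simp add: convolution_assoc)
    then show ?thesis
      using convolution_in_group_algebra by (auto simp: specht_module_def Let_def)
  qed
  have "specht_rep \<mu> (v \<circ> w) =
      matrix_of (specht_basis \<mu>) (\<lambda>x. convolution ?G (delta v) (convolution ?G (delta w) x))"
    unfolding specht_rep_eq
    by (rule matrix_of_cong)
      (use convolution_delta_mult[OF finite_carrier_sym_group] assms in
        \<open>simp add: sym_group_mult sym_group_carrier\<close>)
  also have "\<dots> = specht_rep \<mu> v * specht_rep \<mu> w"
    unfolding specht_rep_eq
    by (rule matrix_of_comp[OF is_ordered_basis_specht_basis linear_convolution_left]) (auto intro: inv)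
  finally show ?thesis .
qed

text \<open>The trace identity for the Young symmetrizer, whose value at the identity is 1. It is
  obtained over the complex numbers and pulled back to the integers.\<close>

lemma specht_dim_dvd_fact:
  assumes "is_partition \<mu>"
  shows "specht_dim \<mu> dvd fact (sum_list \<mu>)"
proof -
  let ?G = "sym_group (sum_list \<mu>)"
  interpret group ?G
    by (rule sym_group_is_group)
  obtain k :: int where "convolution ?G (young_symmetrizer \<mu>) (young_symmetrizer \<mu>) =
      (\<lambda>g. of_int k * young_symmetrizer \<mu> g)"
    using young_symmetrizer_quasi_idempotent[OF assms] by blast
  then have "of_int k * of_nat (specht_dim \<mu>) =
      of_nat (card (carrier ?G)) * young_symmetrizer \<mu> \<one>\<^bsub>?G\<^esub>"
    using trace_quasi_idempotent[OF finite_carrier_sym_group, of "young_symmetrizer \<mu>" "specht_basis \<mu>"]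
      is_ordered_basis_specht_basis[of \<mu>] by (simp add: specht_module_def Let_def)
  moreover have "young_symmetrizer \<mu> \<one>\<^bsub>?G\<^esub> = 1"
    using young_symmetrizer_row_col[of id \<mu> id] subgroup.one_closed[OF subgroup_row_group, of \<mu>]
      subgroup.one_closed[OF subgroup_col_group, of \<mu>] by (simp add: sym_group_one sign_id)
  ultimately have "of_int k * of_nat (specht_dim \<mu>) = (of_nat (fact (sum_list \<mu>)) :: complex)"
    by (simp add: card_carrier_sym_group)
  then have "k * int (specht_dim \<mu>) = int (fact (sum_list \<mu>))"
    by (metis of_int_eq_iff of_int_mult of_int_of_nat_eq)
  then show ?thesis
    by (metis dvd_triv_right int_dvd_int_iff)
qed

section \<open>Induced representations\<close>

context group
begin

lemma mem_l_coset_iff: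
  assumes "subgroup H G" "t \<in> carrier G" "g \<in> carrier G"
  shows "g \<in> t <#\<^bsub>G\<^esub> H \<longleftrightarrow> inv t \<otimes> g \<in> H"
proof
  assume "g \<in> t <#\<^bsub>G\<^esub> H"
  then show "inv t \<otimes> g \<in> H"
    using assms subgroup.mem_carrier[OF assms(1)] by (auto simp: l_coset_def m_assoc[symmetric])
next
  assume "inv t \<otimes> g \<in> H"
  moreover have "g = t \<otimes> (inv t \<otimes> g)"
    using assms by (simp add: m_assoc[symmetric])
  ultimately show "g \<in> t <#\<^bsub>G\<^esub> H"
    unfolding l_coset_def by blast
qed

text \<open>Justifies the \<open>SOME\<close> in \<open>induced_rep\<close>. The representative is a
  function of the coset, so equal cosets share it; this gives uniqueness.\<close>

lemma ex_left_transversal: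
  assumes "finite (carrier G)" "subgroup H G"
  shows "\<exists>ts. left_transversal G H ts"
proof -
  define rep where "rep C = (SOME t. t \<in> C)" for C :: "'a set"
  have rep: "rep (g <#\<^bsub>G\<^esub> H) \<in> g <#\<^bsub>G\<^esub> H" if "g \<in> carrier G" for g
    unfolding rep_def using assms(2) that
    by (intro someI[of "\<lambda>t. t \<in> g <#\<^bsub>G\<^esub> H" g]) (simp add: mem_l_coset_iff subgroup.one_closed)
  have sub: "g <#\<^bsub>G\<^esub> H \<subseteq> carrier G" if "g \<in> carrier G" for g
    using that assms(2) by (auto simp: l_coset_def dest: subgroup.mem_carrier)
  obtain ts where ts: "set ts = (\<lambda>g. rep (g <#\<^bsub>G\<^esub> H)) ` carrier G" "distinct ts"
    using finite_distinct_list assms(1) by (metis finite_imageI)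
  have eq: "rep (g <#\<^bsub>G\<^esub> H) <#\<^bsub>G\<^esub> H = g <#\<^bsub>G\<^esub> H" if "g \<in> carrier G" for g
    using rep l_repr_independence that assms(2) by metis
  have "\<exists>!t. t \<in> set ts \<and> g \<in> t <#\<^bsub>G\<^esub> H" if g: "g \<in> carrier G" for g
  proof (rule ex1I)
    show "rep (g <#\<^bsub>G\<^esub> H) \<in> set ts \<and> g \<in> rep (g <#\<^bsub>G\<^esub> H) <#\<^bsub>G\<^esub> H"
      using ts g eq assms(2) by (auto simp: mem_l_coset_iff subgroup.one_closed)
    fix t assume t: "t \<in> set ts \<and> g \<in> t <#\<^bsub>G\<^esub> H"
    then obtain x where x: "x \<in> carrier G" "t = rep (x <#\<^bsub>G\<^esub> H)"
      using ts by auto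
    then have "g \<in> x <#\<^bsub>G\<^esub> H"
      using t eq by simp
    then show "t = rep (g <#\<^bsub>G\<^esub> H)"
      using x l_repr_independence[OF _ x(1) assms(2)] by simp
  qed
  then show ?thesis
    using ts subsetD[OF sub rep] unfolding left_transversal_def by (intro exI[of _ ts]) auto
qed

text \<open>Lagrange's theorem: the cosets of the transversal elements partition the group.\<close>

lemma length_left_transversal:
  assumes "finite (carrier G)" "subgroup H G" "left_transversal G H ts"
  shows "length ts * card H = card (carrier G)"
proof -
  have ts: "distinct ts" "set ts \<subseteq> carrier G"
    "\<And>g. g \<in> carrier G \<Longrightarrow> \<exists>!t. t \<in> set ts \<and> g \<in> t <#\<^bsub>G\<^esub> H"
    using assms(3) by (auto simp: left_transversal_def)
  have fH: "finite H" and HG: "H \<subseteq> carrier G"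
    using assms subgroup.subset finite_subset by blast+
  have sub: "t <#\<^bsub>G\<^esub> H \<subseteq> carrier G" if "t \<in> set ts" for t
    using that HG ts by (auto simp: l_coset_def)
  have "carrier G = (\<Union>t\<in>set ts. t <#\<^bsub>G\<^esub> H)"
  proof
    show "carrier G \<subseteq> (\<Union>t\<in>set ts. t <#\<^bsub>G\<^esub> H)"
      by (rule subsetI) (metis UN_I ts(3))
  qed (use sub in auto)
  then have "card (carrier G) = card (\<Union>t\<in>set ts. t <#\<^bsub>G\<^esub> H)"
    by simp
  also have "\<dots> = (\<Sum>t\<in>set ts. card (t <#\<^bsub>G\<^esub> H))"
  proof (rule card_UN_disjoint)
    show "\<forall>t\<in>set ts. finite (t <#\<^bsub>G\<^esub> H)"
      using fH by (simp add: l_coset_def)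
    show "\<forall>s\<in>set ts. \<forall>t\<in>set ts. s \<noteq> t \<longrightarrow> (s <#\<^bsub>G\<^esub> H) \<inter> (t <#\<^bsub>G\<^esub> H) = {}"
      using ts(3) sub by (metis disjoint_iff subsetD)
  qed simp
  also have "\<dots> = (\<Sum>t\<in>set ts. card H)"
  proof (rule sum.cong)
    fix t assume "t \<in> set ts"
    then have "inj_on ((\<otimes>) t) H"
      using ts(2) HG 
      by (intro inj_on_inverseI[where g = "(\<otimes>) (inv t)"]) (auto simp: mult_inv_cancel subset_iff)
    moreover have "t <#\<^bsub>G\<^esub> H = (\<otimes>) t ` H"
      by (auto simp: l_coset_def)
    ultimately show "card (t <#\<^bsub>G\<^esub> H) = card H"
      by (simp add: card_image)
  qed simp
  finally show ?thesis
    using ts(1) by (simp add: distinct_card)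
qed

end

section \<open>Matrices of induced representations\<close>

definition extended_entry ::
  "'g set \<Rightarrow> ('g \<Rightarrow> complex mat) \<Rightarrow> 'g \<Rightarrow> nat \<Rightarrow> nat \<Rightarrow> complex" where
  "extended_entry H R g p q = (if g \<in> H then R g $$ (p, q) else 0)"

lemma sum_blocks: "(\<Sum>k<L * d. F (k div d) (k mod d)) = (\<Sum>l<L. \<Sum>p<d. F l p)"
  for F :: "nat \<Rightarrow> nat \<Rightarrow> 'a::comm_monoid_add"
proof (cases "d = 0")
  \<comment> \<open>For \<open>d = 0\<close> both sides are zero; otherwise \<open>l * d + p\<close>
    encodes the pair \<open>(l, p)\<close>.\<close>
  case False
  have "(\<Sum>l<L. \<Sum>p<d. F l p) = (\<Sum>(l, p)\<in>{..<L} \<times> {..<d}. F l p)"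
    by (simp add: sum.cartesian_product)
  also have "\<dots> = (\<Sum>k<L * d. F (k div d) (k mod d))"
  proof -
    have "l * d + p < L * d" if "l < L" "p < d" for l p
      using mult_le_mono1[of "Suc l" L d] that by simp
    then show ?thesis
      using False by (intro sum.reindex_bij_witness[of _ "\<lambda>k. (k div d, k mod d)" "\<lambda>(l, p). l * d + p"])
        (auto simp: less_mult_imp_div_less)
  qed
  finally show ?thesis ..
qed simp

text \<open>\<open>R_one\<close> ties the parameter \<open>d\<close> to
  \<open>dim_row (R \<one>)\<close>, from which \<open>induced_rep\<close> takes its block
  size.\<close>

locale matrix_subgroup_rep = group G for G (structure) +
  fixes H :: "'a set" and R :: "'a \<Rightarrow> complex mat" and d :: nat
  assumes fin: "finite (carrier G)" and subgroup_H: "subgroup H G"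
    and R_carrier: "\<And>h. h \<in> H \<Longrightarrow> R h \<in> carrier_mat d d"
    and R_one: "R \<one> = 1\<^sub>m d"
    and R_mult: "\<And>h k. h \<in> H \<Longrightarrow> k \<in> H \<Longrightarrow> R (h \<otimes> k) = R h * R k"
begin

abbreviation "E \<equiv> extended_entry H R"

lemma H_carrier: "h \<in> H \<Longrightarrow> h \<in> carrier G"
  by (rule subgroup.mem_carrier[OF subgroup_H])

text \<open>Exactly one transversal element \<open>t\<close> has \<open>a \<otimes> t\<close> in
  \<open>H\<close>, namely the representative of the coset of \<open>inv a\<close>, and
  \<open>a \<otimes> b\<close> is the product of \<open>a \<otimes> t\<close> and
  \<open>inv t \<otimes> b\<close>. With \<open>a\<close> and \<open>b\<close> arbitrary this
  evaluates every product in the change of coordinates below.\<close>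

lemma sum_transversal:
  assumes ts: "left_transversal G H ts" and a: "a \<in> carrier G" and b: "b \<in> carrier G"
    and p: "p < d" and q: "q < d"
  shows "(\<Sum>l<length ts. \<Sum>k<d. E (a \<otimes> ts ! l) p k * E (inv (ts ! l) \<otimes> b) k q) = E (a \<otimes> b) p q"
proof -
  have tsG: "set ts \<subseteq> carrier G" and di: "distinct ts"
    using ts by (auto simp: left_transversal_def)
  have "\<exists>!t. t \<in> set ts \<and> inv a \<in> t <#\<^bsub>G\<^esub> H"
    using ts a by (simp add: left_transversal_def)
  then obtain t where t: "t \<in> set ts" "inv a \<in> t <#\<^bsub>G\<^esub> H"
    and uniq: "\<And>s. s \<in> set ts \<Longrightarrow> inv a \<in> s <#\<^bsub>G\<^esub> H \<Longrightarrow> s = t"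
    by blast
  have mem: "inv a \<in> s <#\<^bsub>G\<^esub> H \<longleftrightarrow> a \<otimes> s \<in> H" if "s \<in> set ts" for s
  proof -
    have s: "s \<in> carrier G"
      using that tsG by blast
    have "inv (a \<otimes> s) \<in> H \<longleftrightarrow> a \<otimes> s \<in> H"
      using subgroup.m_inv_closed[OF subgroup_H, of "a \<otimes> s"]
        subgroup.m_inv_closed[OF subgroup_H, of "inv (a \<otimes> s)"] a s by auto
    then show ?thesis
      using a s by (simp add: mem_l_coset_iff[OF subgroup_H] inv_mult_group)
  qed
  have tG: "t \<in> carrier G" and atH: "a \<otimes> t \<in> H"
    using t tsG mem by auto
  have ab: "a \<otimes> b = (a \<otimes> t) \<otimes> (inv t \<otimes> b)"
    using a b tG by (simp add: m_assoc mult_inv_cancel)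
  have tb: "inv t \<otimes> b = inv (a \<otimes> t) \<otimes> (a \<otimes> b)"
    using a b tG by (simp add: m_assoc mult_inv_cancel inv_mult_group)
  have iff: "inv t \<otimes> b \<in> H \<longleftrightarrow> a \<otimes> b \<in> H"
  proof
    show "a \<otimes> b \<in> H" if "inv t \<otimes> b \<in> H"
      unfolding ab by (rule subgroup.m_closed[OF subgroup_H atH that])
    show "inv t \<otimes> b \<in> H" if "a \<otimes> b \<in> H"
      unfolding tb by (rule subgroup.m_closed[OF subgroup_H subgroup.m_inv_closed[OF subgroup_H atH] that])
  qed
  have "(\<Sum>l<length ts. \<Sum>k<d. E (a \<otimes> ts ! l) p k * E (inv (ts ! l) \<otimes> b) k q) =
      (\<Sum>s\<in>set ts. \<Sum>k<d. E (a \<otimes> s) p k * E (inv s \<otimes> b) k q)"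
    by (rule sum.reindex_bij_betw) (simp add: bij_betw_nth[OF di])
  also have "\<dots> = (\<Sum>s\<in>{t}. \<Sum>k<d. E (a \<otimes> s) p k * E (inv s \<otimes> b) k q)"
  proof (rule sum.mono_neutral_right)
    show "\<forall>s\<in>set ts - {t}. (\<Sum>k<d. E (a \<otimes> s) p k * E (inv s \<otimes> b) k q) = 0"
    proof
      fix s assume "s \<in> set ts - {t}"
      then have "a \<otimes> s \<notin> H"
        using uniq mem by blast
      then show "(\<Sum>k<d. E (a \<otimes> s) p k * E (inv s \<otimes> b) k q) = 0"
        by (simp add: extended_entry_def)
    qed
  qed (use t in auto)
  also have "\<dots> = E (a \<otimes> b) p q"
  proof (cases "a \<otimes> b \<in> H")
    case True
    then have tbH: "inv t \<otimes> b \<in> H"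
      using iff by simp
    have "R (a \<otimes> b) = R (a \<otimes> t) * R (inv t \<otimes> b)"
      using ab R_mult atH tbH by simp
    then show ?thesis
      using True atH tbH p q R_carrier[OF atH] R_carrier[OF tbH]
      by (simp add: extended_entry_def scalar_prod_def atLeast0LessThan)
  qed (use iff in \<open>simp add: extended_entry_def\<close>)
  finally show ?thesis .
qed

definition transversal :: "'a list" where
  "transversal = (SOME ts. left_transversal G H ts)"

lemma left_transversal_transversal: "left_transversal G H transversal"
  unfolding transversal_def by (rule someI_ex) (rule ex_left_transversal[OF fin subgroup_H])

lemma transversal_nth_carrier: "i < length transversal \<Longrightarrow> transversal ! i \<in> carrier G"
  using left_transversal_transversal by (auto simp: left_transversal_def)

lemma induced_rep_eq:
  "induced_rep G H R g = mat (length transversal * d) (length transversal * d)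
     (\<lambda>(i, j). E (inv (transversal ! (i div d)) \<otimes> g \<otimes> transversal ! (j div d)) (i mod d) (j mod d))"
proof -
  have "dim_row (R \<one>) = d"
    by (simp add: R_one)
  then show ?thesis
    by (simp add: induced_rep_def Let_def transversal_def extended_entry_def)
qed

end

text \<open>The coordinate change between the two induced representations has the blocks
  \<open>\<chi>(t\<^sub>i)\<inverse> R' (u t\<^sub>i\<inverse> t'\<^sub>l)\<close>, read as zero outside \<open>H'\<close>, with rows permuted by \<open>\<sigma>\<close>.\<close>

lemma (in group) det_induced_rep_conjugate:
  assumes R: "matrix_subgroup_rep G H R d" and R': "matrix_subgroup_rep G H' R' d"
    and u: "u \<in> carrier G"
    and conj: "\<And>h. h \<in> carrier G \<Longrightarrow> h \<in> H \<longleftrightarrow> u \<otimes> h \<otimes> inv u \<in> H'"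
    and \<sigma>: "inj_on \<sigma> {..<d}" "\<And>p. p < d \<Longrightarrow> \<sigma> p < d"
    and \<chi>0: "\<And>g. g \<in> carrier G \<Longrightarrow> \<chi> g \<noteq> (0::complex)"
    and \<chi>: "\<And>g h. g \<in> carrier G \<Longrightarrow> h \<in> carrier G \<Longrightarrow> \<chi> (g \<otimes> h) = \<chi> g * \<chi> h"
    and RR': "\<And>h p q. h \<in> H \<Longrightarrow> p < d \<Longrightarrow> q < d \<Longrightarrow>
        R h $$ (p, q) = \<chi> h * R' (u \<otimes> h \<otimes> inv u) $$ (\<sigma> p, \<sigma> q)"
    and g: "g \<in> carrier G"
  shows "dim_row (induced_rep G H R g) = dim_row (induced_rep G H' R' g)"
    and "det (induced_rep G H R g) =
      \<chi> g ^ dim_row (induced_rep G H R g) * det (induced_rep G H' R' g)"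
proof -
  interpret R: matrix_subgroup_rep G H R d by (rule R)
  interpret R': matrix_subgroup_rep G H' R' d by (rule R')
  define L where "L = length R.transversal"
  define t where "t i = R.transversal ! i" for i
  define t' where "t' i = R'.transversal ! i" for i
  have tG: "t i \<in> carrier G" if "i < L" for i
    using that R.transversal_nth_carrier by (simp add: L_def t_def)
  have \<chi>1: "\<chi> \<one> = 1"
    using \<chi>[of \<one> \<one>] \<chi>0[of \<one>] by simp
  have \<chi>inv: "\<chi> (inv h) = inverse (\<chi> h)" if "h \<in> carrier G" for h
    using \<chi>[of "inv h" h] \<chi>0[of h] \<chi>1 that by (simp add: field_simps)
  have EE': "R.E h p q = \<chi> h * R'.E (u \<otimes> h \<otimes> inv u) (\<sigma> p) (\<sigma> q)"
    if "h \<in> carrier G" "p < d" "q < d" for h p q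
    using that conj RR' by (simp add: extended_entry_def)
  \<comment> \<open>Conjugate subgroups have equal order, so the two transversals have the same
    length and the induced matrices the same size.\<close>
  have "bij_betw (\<lambda>h. u \<otimes> h \<otimes> inv u) H H'"
  proof (rule bij_betw_byWitness[where f' = "\<lambda>h. inv u \<otimes> h \<otimes> u"])
    show "(\<lambda>h. u \<otimes> h \<otimes> inv u) ` H \<subseteq> H'"
      using conj R.H_carrier by blast
    show "(\<lambda>h. inv u \<otimes> h \<otimes> u) ` H' \<subseteq> H"
    proof clarify
      fix h assume h: "h \<in> H'"
      then have "u \<otimes> (inv u \<otimes> h \<otimes> u) \<otimes> inv u = h"
        using u R'.H_carrier by (simp add: m_assoc mult_inv_cancel)
      then show "inv u \<otimes> h \<otimes> u \<in> H"
        using h u R'.H_carrier conj[of "inv u \<otimes> h \<otimes> u"] by simp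
    qed
  qed (use u R.H_carrier R'.H_carrier in \<open>simp_all add: m_assoc mult_inv_cancel\<close>)
  then have "card H = card H'"
    by (rule bij_betw_same_card)
  moreover have "card H' > 0"
    using R'.subgroup_H R'.fin by (metis R.fin card_gt_0_iff empty_iff finite_subset subgroup.one_closed subgroup.subset)
  ultimately have L': "length R'.transversal = L"
    using length_left_transversal[OF R.fin R.subgroup_H R.left_transversal_transversal]
      length_left_transversal[OF R.fin R'.subgroup_H R'.left_transversal_transversal]
    by (metis L_def mult_right_cancel not_less0)
  have t'G: "t' i \<in> carrier G" if "i < L" for i
    using that R'.transversal_nth_carrier by (simp add: L' t'_def)
  define N where "N = L * d"
  define M where "M h = induced_rep G H R h" for h
  define M' where "M' h = induced_rep G H' R' h" for h
  have M: "M h = mat N N (\<lambda>(i, j). R.E (inv (t (i div d)) \<otimes> h \<otimes> t (j div d)) (i mod d) (j mod d))" for h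
    by (simp add: M_def R.induced_rep_eq L_def N_def t_def)
  have M': "M' h = mat N N (\<lambda>(i, j). R'.E (inv (t' (i div d)) \<otimes> h \<otimes> t' (j div d)) (i mod d) (j mod d))" for h
    by (simp add: M'_def R'.induced_rep_eq L' N_def t'_def)
  show "dim_row (induced_rep G H R g) = dim_row (induced_rep G H' R' g)"
    unfolding M_def[symmetric] M'_def[symmetric] by (simp add: M M')
  define X where "X = mat N N (\<lambda>(i, l).
      inverse (\<chi> (t (i div d))) * R'.E (u \<otimes> inv (t (i div d)) \<otimes> t' (l div d)) (\<sigma> (i mod d)) (l mod d))"
  \<comment> \<open>The counterpart of \<open>X\<close>: in the sum over \<open>l\<close> the
    elements \<open>t' l\<close> cancel against their inverses, so that \<open>X * Y\<close> has, up
    to values of \<open>\<chi>\<close>, the blocks of \<open>R'\<close> at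
    \<open>u (t i)^-1 (t j) u^-1\<close>.\<close>
  define Y where "Y = mat N N (\<lambda>(l, j).
      \<chi> (t (j div d)) * R'.E (inv (t' (l div d)) \<otimes> t (j div d) \<otimes> inv u) (l mod d) (\<sigma> (j mod d)))"
  have dpos: "d > 0" "i div d < L" "i mod d < d" if "i < N" for i
    using that unfolding N_def by (cases "d = 0"; simp add: less_mult_imp_div_less)+
  note tr = R'.left_transversal_transversal
  have XM': "X * M' g = mat N N (\<lambda>(i, l). inverse (\<chi> (t (i div d))) *
      R'.E (u \<otimes> inv (t (i div d)) \<otimes> g \<otimes> t' (l div d)) (\<sigma> (i mod d)) (l mod d))" (is "_ = ?XM")
  proof (rule eq_matI)
    fix i j assume "i < dim_row ?XM" and "j < dim_col ?XM"
    then have i: "i < N" and j: "j < N" by auto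
    have "(X * M' g) $$ (i, j) = (\<Sum>k<L * d. inverse (\<chi> (t (i div d))) *
        (R'.E (u \<otimes> inv (t (i div d)) \<otimes> t' (k div d)) (\<sigma> (i mod d)) (k mod d) *
         R'.E (inv (t' (k div d)) \<otimes> (g \<otimes> t' (j div d))) (k mod d) (j mod d)))"
      using i j by (auto simp: X_def M' scalar_prod_def N_def atLeast0LessThan m_assoc g t'G
          less_mult_imp_div_less mult.assoc intro!: sum.cong)
    also have "\<dots> = inverse (\<chi> (t (i div d))) * (\<Sum>l<L. \<Sum>k<d.
        R'.E (u \<otimes> inv (t (i div d)) \<otimes> t' l) (\<sigma> (i mod d)) k *
        R'.E (inv (t' l) \<otimes> (g \<otimes> t' (j div d))) k (j mod d))"
      by (subst sum_blocks) (simp add: sum_distrib_left)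
    also have "\<dots> = inverse (\<chi> (t (i div d))) *
        R'.E (u \<otimes> inv (t (i div d)) \<otimes> (g \<otimes> t' (j div d))) (\<sigma> (i mod d)) (j mod d)"
      using R'.sum_transversal[OF tr, of "u \<otimes> inv (t (i div d))" "g \<otimes> t' (j div d)" "\<sigma> (i mod d)" "j mod d"]
        i j u g tG t'G dpos \<sigma>(2) by (simp add: L' t'_def)
    finally show "(X * M' g) $$ (i, j) = ?XM $$ (i, j)"
      using i j u g tG t'G dpos by (simp add: m_assoc)
  qed (simp_all add: X_def M')
  \<comment> \<open>The value of \<open>\<chi>\<close> at
    \<open>inv (t i) \<otimes> h \<otimes> t j\<close> splits into \<open>\<chi> h\<close> and the
    two factors built into \<open>X\<close> and \<open>Y\<close>; the conjugated blocks thus turn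
    back into the blocks over \<open>H\<close>.\<close>
  have absorb: "\<chi> h * R'.E (u \<otimes> inv (t (i div d)) \<otimes> h \<otimes> t (j div d) \<otimes> inv u) (\<sigma> (i mod d)) (\<sigma> (j mod d)) *
      inverse (\<chi> (t (i div d))) * \<chi> (t (j div d)) = M h $$ (i, j)"
    if "i < N" "j < N" "h \<in> carrier G" for i j h
    using that u tG dpos EE'[of "inv (t (i div d)) \<otimes> h \<otimes> t (j div d)" "i mod d" "j mod d"]
    by (simp add: M \<chi> \<chi>inv m_assoc)
  have XM'Y: "\<chi> g \<cdot>\<^sub>m (X * M' g * Y) = M g"
  proof (rule eq_matI)
    fix i j assume "i < dim_row (M g)" and "j < dim_col (M g)"
    then have i: "i < N" and j: "j < N" by (auto simp: M)
    have "(X * M' g * Y) $$ (i, j) = (\<Sum>k<L * d. inverse (\<chi> (t (i div d))) * \<chi> (t (j div d)) *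
        (R'.E (u \<otimes> inv (t (i div d)) \<otimes> g \<otimes> t' (k div d)) (\<sigma> (i mod d)) (k mod d) *
         R'.E (inv (t' (k div d)) \<otimes> (t (j div d) \<otimes> inv u)) (k mod d) (\<sigma> (j mod d))))"
      unfolding XM' using i j dpos tG t'G u
      by (auto simp: Y_def scalar_prod_def N_def atLeast0LessThan m_assoc 
          less_mult_imp_div_less intro!: sum.cong)
    also have "\<dots> = inverse (\<chi> (t (i div d))) * \<chi> (t (j div d)) * (\<Sum>l<L. \<Sum>k<d.
        R'.E (u \<otimes> inv (t (i div d)) \<otimes> g \<otimes> t' l) (\<sigma> (i mod d)) k *
        R'.E (inv (t' l) \<otimes> (t (j div d) \<otimes> inv u)) k (\<sigma> (j mod d)))"
      by (subst sum_blocks) (simp add: sum_distrib_left)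
    also have "\<dots> = inverse (\<chi> (t (i div d))) * \<chi> (t (j div d)) *
        R'.E (u \<otimes> inv (t (i div d)) \<otimes> g \<otimes> (t (j div d) \<otimes> inv u)) (\<sigma> (i mod d)) (\<sigma> (j mod d))"
      using R'.sum_transversal[OF tr, of "u \<otimes> inv (t (i div d)) \<otimes> g" "t (j div d) \<otimes> inv u"
          "\<sigma> (i mod d)" "\<sigma> (j mod d)"] i j u g tG dpos \<sigma>(2) by (simp add: L' t'_def)
    finally show "(\<chi> g \<cdot>\<^sub>m (X * M' g * Y)) $$ (i, j) = M g $$ (i, j)"
      using absorb[OF i j g] i j u g tG t'G dpos by (simp add: m_assoc X_def Y_def M' mult_ac)
  qed (simp_all add: X_def M Y_def)
  \<comment> \<open>The previous computation with \<open>\<one>\<close> in place of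
    \<open>g\<close>. The result is the identity matrix, since distinct transversal elements lie in
    distinct cosets of \<open>H\<close>.\<close>
  have XY: "X * Y = 1\<^sub>m N"
  proof (rule eq_matI)
    fix i j assume "i < dim_row (1\<^sub>m N :: complex mat)" and "j < dim_col (1\<^sub>m N :: complex mat)"
    then have i: "i < N" and j: "j < N" by auto
    have "(X * Y) $$ (i, j) = (\<Sum>k<L * d. inverse (\<chi> (t (i div d))) * \<chi> (t (j div d)) *
        (R'.E (u \<otimes> inv (t (i div d)) \<otimes> t' (k div d)) (\<sigma> (i mod d)) (k mod d) *
         R'.E (inv (t' (k div d)) \<otimes> (t (j div d) \<otimes> inv u)) (k mod d) (\<sigma> (j mod d))))"
      using i j dpos tG t'G u
      by (auto simp: X_def Y_def scalar_prod_def N_def atLeast0LessThan m_assoc 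
          less_mult_imp_div_less intro!: sum.cong)
    also have "\<dots> = inverse (\<chi> (t (i div d))) * \<chi> (t (j div d)) * (\<Sum>l<L. \<Sum>k<d.
        R'.E (u \<otimes> inv (t (i div d)) \<otimes> t' l) (\<sigma> (i mod d)) k *
        R'.E (inv (t' l) \<otimes> (t (j div d) \<otimes> inv u)) k (\<sigma> (j mod d)))"
      by (subst sum_blocks) (simp add: sum_distrib_left)
    also have "\<dots> = inverse (\<chi> (t (i div d))) * \<chi> (t (j div d)) *
        R'.E (u \<otimes> inv (t (i div d)) \<otimes> (t (j div d) \<otimes> inv u)) (\<sigma> (i mod d)) (\<sigma> (j mod d))"
      using R'.sum_transversal[OF tr, of "u \<otimes> inv (t (i div d))" "t (j div d) \<otimes> inv u"
          "\<sigma> (i mod d)" "\<sigma> (j mod d)"] i j u tG dpos \<sigma>(2) by (simp add: L' t'_def)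
    also have "\<dots> = M \<one> $$ (i, j)"
      using absorb[OF i j one_closed] i j u tG dpos by (simp add: m_assoc \<chi>1 mult_ac)
    also have "\<dots> = R.E (inv (t (i div d)) \<otimes> t (j div d)) (i mod d) (j mod d)"
      using i j tG dpos by (simp add: M)
    also have "\<dots> = 1\<^sub>m N $$ (i, j)"
    proof (cases "inv (t (i div d)) \<otimes> t (j div d) \<in> H")
      case True
      let ?s = "t (j div d)" and ?t = "t (i div d)"
      have lt: "left_transversal G H R.transversal"
        by (rule R.left_transversal_transversal)
      have "?s \<in> ?t <#\<^bsub>G\<^esub> H" "?s \<in> ?s <#\<^bsub>G\<^esub> H"
        using True i j dpos tG subgroup.one_closed[OF R.subgroup_H]
        by (simp_all add: mem_l_coset_iff[OF R.subgroup_H])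
      moreover have mem: "?s \<in> set R.transversal" "?t \<in> set R.transversal"
        using i j dpos by (simp_all add: t_def L_def)
      ultimately have "?s = ?t"
        using lt tG[of "j div d"] j dpos unfolding left_transversal_def by blast
      moreover from this have "i div d = j div d"
        using lt i j dpos by (simp add: left_transversal_def t_def L_def nth_eq_iff_index_eq)
      ultimately show ?thesis
        using True i j dpos tG by (auto simp: extended_entry_def R.R_one)
          (metis div_mult_mod_eq)
    next
      case False
      then have "i \<noteq> j"
        using i dpos tG subgroup.one_closed[OF R.subgroup_H] by auto
      then show ?thesis
        using False i j by (simp add: extended_entry_def)
    qed
    finally show "(X * Y) $$ (i, j) = 1\<^sub>m N $$ (i, j)" .
  qed (simp_all add: X_def Y_def)
  have carr: "X \<in> carrier_mat N N" "Y \<in> carrier_mat N N" "M' g \<in> carrier_mat N N"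
    by (simp_all add: X_def Y_def M')
  \<comment> \<open>A one-sided inverse is enough, because the two determinants enter only through
    their product.\<close>
  have "det X * det Y = 1"
    using det_mult[OF carr(1,2)] XY by simp
  moreover have "det (M g) = \<chi> g ^ N * (det X * det (M' g) * det Y)"
    unfolding XM'Y[symmetric] using carr by (simp add: det_mult[of _ N])
  moreover have "dim_row (M g) = N"
    by (simp add: M)
  ultimately show "det (induced_rep G H R g) =
      \<chi> g ^ dim_row (induced_rep G H R g) * det (induced_rep G H' R' g)"
    by (simp add: M_def M'_def mult_ac)
qed

section \<open>Kronecker products\<close>

lemma kronecker_carrier:
  "A \<in> carrier_mat m m' \<Longrightarrow> B \<in> carrier_mat n n' \<Longrightarrow> kronecker A B \<in> carrier_mat (m * n) (m' * n')"
  by (auto simp: kronecker_def)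

lemma kronecker_index:
  assumes "A \<in> carrier_mat m m'" "B \<in> carrier_mat n n'" "i < m * n" "j < m' * n'"
  shows "kronecker A B $$ (i, j) = A $$ (i div n, j div n') * B $$ (i mod n, j mod n')"
  using assms by (auto simp: kronecker_def)

lemma div_mod_less:
  assumes "i < m * (n::nat)"
  shows "i div n < m" "i mod n < n"
  using assms by (cases "n = 0"; simp add: less_mult_imp_div_less)+

text \<open>Quotient and remainder by \<open>n\<close> split the summation index into two
  independent ones, and the sum factors.\<close>

lemma kronecker_mult:
  assumes A: "A \<in> carrier_mat m m" "A' \<in> carrier_mat m m" and B: "B \<in> carrier_mat n n" "B' \<in> carrier_mat n n"
  shows "kronecker (A * A') (B * B') = kronecker A B * kronecker A' B'"
proof (rule eq_matI)
  note carr = kronecker_carrier[OF A(1) B(1)] kronecker_carrier[OF A(2) B(2)]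
  fix i j assume "i < dim_row (kronecker A B * kronecker A' B')"
    and "j < dim_col (kronecker A B * kronecker A' B')"
  then have ij: "i < m * n" "j < m * n"
    using carr by auto
  note dm = div_mod_less[OF ij(1)] div_mod_less[OF ij(2)]
  have "(kronecker A B * kronecker A' B') $$ (i, j) =
      (\<Sum>k<m * n. kronecker A B $$ (i, k) * kronecker A' B' $$ (k, j))"
    using ij carr by (auto simp: scalar_prod_def atLeast0LessThan)
  also have "\<dots> = (\<Sum>k<m * n. (A $$ (i div n, k div n) * B $$ (i mod n, k mod n)) *
      (A' $$ (k div n, j div n) * B' $$ (k mod n, j mod n)))"
    using ij by (intro sum.cong) (simp_all add: kronecker_index[OF A(1) B(1)] kronecker_index[OF A(2) B(2)])
  also have "\<dots> = (\<Sum>k<m. \<Sum>l<n. (A $$ (i div n, k) * B $$ (i mod n, l)) * (A' $$ (k, j div n) * B' $$ (l, j mod n)))"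
    by (rule sum_blocks)
  also have "\<dots> = (\<Sum>k<m. A $$ (i div n, k) * A' $$ (k, j div n)) * (\<Sum>l<n. B $$ (i mod n, l) * B' $$ (l, j mod n))"
    by (simp add: sum_product mult_ac)
  also have "\<dots> = kronecker (A * A') (B * B') $$ (i, j)"
    using ij dm A B by (subst kronecker_index[of _ m m _ n n]) (auto simp: scalar_prod_def atLeast0LessThan)
  finally show "kronecker (A * A') (B * B') $$ (i, j) = (kronecker A B * kronecker A' B') $$ (i, j)" ..
qed (use assms in \<open>auto simp: kronecker_def\<close>)

lemma kronecker_one: "kronecker (1\<^sub>m m) (1\<^sub>m n) = 1\<^sub>m (m * n)"
proof (rule eq_matI)
  fix i j assume "i < dim_row (1\<^sub>m (m * n) :: complex mat)" "j < dim_col (1\<^sub>m (m * n) :: complex mat)"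
  then have ij: "i < m * n" "j < m * n"
    by auto
  have "i = j" if "i div n = j div n" "i mod n = j mod n"
    using that by (metis div_mult_mod_eq)
  then show "kronecker (1\<^sub>m m) (1\<^sub>m n) $$ (i, j) = 1\<^sub>m (m * n) $$ (i, j)"
    using ij div_mod_less[OF ij(1)] div_mod_less[OF ij(2)]
    by (subst kronecker_index[of _ m m _ n n]) auto
qed (auto simp: kronecker_def)

lemma kronecker_smult: "kronecker (a \<cdot>\<^sub>m A) (b \<cdot>\<^sub>m B) = (a * b) \<cdot>\<^sub>m kronecker A B"
proof (rule eq_matI)
  fix i j assume "i < dim_row ((a * b) \<cdot>\<^sub>m kronecker A B)" "j < dim_col ((a * b) \<cdot>\<^sub>m kronecker A B)"
  then have ij: "i < dim_row A * dim_row B" "j < dim_col A * dim_col B"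
    by (auto simp: kronecker_def)
  show "kronecker (a \<cdot>\<^sub>m A) (b \<cdot>\<^sub>m B) $$ (i, j) = ((a * b) \<cdot>\<^sub>m kronecker A B) $$ (i, j)"
    using ij div_mod_less[OF ij(1)] div_mod_less[OF ij(2)] by (simp add: kronecker_def)
qed (auto simp: kronecker_def)

text \<open>An equality and not just a similarity: both bracketings read the same three mixed-radix
  digits of an index.\<close>

lemma kronecker_assoc: "kronecker (kronecker A B) C = kronecker A (kronecker B C)"
proof (rule eq_matI)
  fix i j assume "i < dim_row (kronecker A (kronecker B C))" "j < dim_col (kronecker A (kronecker B C))"
  then have ij: "i < dim_row A * dim_row B * dim_row C" "j < dim_col A * dim_col B * dim_col C"
    by (auto simp: kronecker_def mult.assoc)
  then have ij': "i < dim_row A * (dim_row B * dim_row C)" "j < dim_col A * (dim_col B * dim_col C)"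
    by (auto simp: mult.assoc)
  \<comment> \<open>\<open>div_mult2_eq\<close> and \<open>mod_mult2_eq\<close> split off the left
    factor of the divisor first, but the lowest digit belongs to \<open>C\<close>; hence the
    products are turned round.\<close>
  have comm: "dim_row B * dim_row C = dim_row C * dim_row B" "dim_col B * dim_col C = dim_col C * dim_col B"
    by simp_all
  have pos: "0 < dim_row C" "0 < dim_col C"
    using ij by (auto intro: Nat.gr0I)
  have "kronecker (kronecker A B) C $$ (i, j) =
      A $$ (i div dim_row C div dim_row B, j div dim_col C div dim_col B) *
      B $$ (i div dim_row C mod dim_row B, j div dim_col C mod dim_col B) *
      C $$ (i mod dim_row C, j mod dim_col C)"
    using ij div_mod_less[OF ij(1)] div_mod_less[OF ij(2)] by (simp add: kronecker_def)
  also have "\<dots> = A $$ (i div (dim_row B * dim_row C), j div (dim_col B * dim_col C)) *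
      (B $$ (i mod (dim_row B * dim_row C) div dim_row C, j mod (dim_col B * dim_col C) div dim_col C) *
      C $$ (i mod (dim_row B * dim_row C) mod dim_row C, j mod (dim_col B * dim_col C) mod dim_col C))"
    unfolding comm using pos by (simp add: div_mult2_eq mod_mult2_eq)
  also have "\<dots> = kronecker A (kronecker B C) $$ (i, j)"
    using ij' div_mod_less[OF ij'(1)] div_mod_less[OF ij'(2)] by (simp add: kronecker_def)
  finally show "kronecker (kronecker A B) C $$ (i, j) = kronecker A (kronecker B C) $$ (i, j)" .
qed (auto simp: kronecker_def)

lemma kronecker_one_left: "kronecker (1\<^sub>m 1) A = A" and kronecker_one_right: "kronecker A (1\<^sub>m 1) = A"
  by (rule eq_matI; simp add: kronecker_def)+

lemma kronecker_list_simps [simp]: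
  "kronecker_list [] = 1\<^sub>m 1" "kronecker_list (A # As) = kronecker A (kronecker_list As)"
  by (simp_all add: kronecker_list_def)

text \<open>\<open>foldr\<close> exposes the front factor, whereas rotation puts the moved factor at
  the back; associativity bridges the two.\<close>

lemma kronecker_list_snoc: "kronecker_list (As @ [B]) = kronecker (kronecker_list As) B"
  using kronecker_one_left kronecker_one_right by (induction As) (simp_all add: kronecker_assoc)

lemma kronecker_list_carrier:
  assumes "\<And>k. k \<in> set ks \<Longrightarrow> F k \<in> carrier_mat (d k) (d k)"
  shows "kronecker_list (map F ks) \<in> carrier_mat (prod_list (map d ks)) (prod_list (map d ks))"
  using assms by (induction ks) (auto intro!: kronecker_carrier)

lemma kronecker_list_mult:
  assumes "\<And>k. k \<in> set ks \<Longrightarrow> F k \<in> carrier_mat (d k) (d k)" "\<And>k. k \<in> set ks \<Longrightarrow> F' k \<in> carrier_mat (d k) (d k)"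
  shows "kronecker_list (map (\<lambda>k. F k * F' k) ks) = kronecker_list (map F ks) * kronecker_list (map F' ks)"
  using assms
proof (induction ks)
  case (Cons k ks)
  then show ?case
    using kronecker_mult[of "F k" "d k" "F' k" _ "prod_list (map d ks)"]
      kronecker_list_carrier[of ks F d] kronecker_list_carrier[of ks F' d] by simp
qed simp

lemma kronecker_list_one: "kronecker_list (map (\<lambda>k. 1\<^sub>m (d k)) ks) = 1\<^sub>m (prod_list (map d ks))"
  by (induction ks) (simp_all add: kronecker_one)

lemma kronecker_list_smult:
  "kronecker_list (map (\<lambda>k. c k \<cdot>\<^sub>m F k) ks) = prod_list (map c ks) \<cdot>\<^sub>m kronecker_list (map F ks)"
  by (induction ks) (auto simp: kronecker_smult intro!: eq_matI)

text \<open>Exchanges the digits \<open>i div n\<close> and \<open>i mod n\<close> of an index. This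
  perfect shuffle turns a Kronecker product into the one with the factors in opposite order; it will
  serve as the \<open>\<sigma>\<close> of the change of coordinates.\<close>

definition swap_factors :: "nat \<Rightarrow> nat \<Rightarrow> nat \<Rightarrow> nat" where
  "swap_factors m n i = (i mod n) * m + i div n"

lemma swap_factors_props:
  assumes "i < m * n"
  shows "swap_factors m n i < n * m"
    and "swap_factors m n i div m = i mod n" "swap_factors m n i mod m = i div n"
proof -
  note dm = div_mod_less[OF assms]
  show "swap_factors m n i < n * m"
    using mult_le_mono1[of "Suc (i mod n)" n m] dm by (simp add: swap_factors_def)
  show "swap_factors m n i div m = i mod n" "swap_factors m n i mod m = i div n"
    using dm by (simp_all add: swap_factors_def)
qed

lemma inj_on_swap_factors: "inj_on (swap_factors m n) {..<m * n}"
proof (rule inj_onI)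
  fix i j assume ij: "i \<in> {..<m * n}" "j \<in> {..<m * n}" "swap_factors m n i = swap_factors m n j"
  then have "i mod n = j mod n" "i div n = j div n"
    using swap_factors_props[of i m n] swap_factors_props[of j m n] by auto
  then show "i = j"
    by (metis div_mult_mod_eq)
qed

lemma kronecker_swap:
  assumes "A \<in> carrier_mat m m" "B \<in> carrier_mat n n" "i < m * n" "j < m * n"
  shows "kronecker A B $$ (i, j) = kronecker B A $$ (swap_factors m n i, swap_factors m n j)"
  using assms swap_factors_props[OF assms(3)] swap_factors_props[OF assms(4)]
  by (simp add: kronecker_index[of _ m m _ n n] kronecker_index[of _ n n _ m m])

section \<open>Wreath products and their block subgroups\<close>

lemma wreath_carrier:
  "0 < r \<Longrightarrow> carrier (wreath n r) = ({1..n} \<rightarrow>\<^sub>E {0..<int r}) \<times> {w. w permutes {1..n}}"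
  by (simp add: wreath_def semidirect_product_def sym_group_def carrier_integer_mod_group)

lemma wreath_mult:
  "(x, u) \<otimes>\<^bsub>wreath n r\<^esub> (y, v) = (\<lambda>i\<in>{1..n}. (x i + y (inv' u i)) mod int r, u \<circ> v)"
  by (auto simp: wreath_def semidirect_product_def sym_group_def intro!: restrict_ext)

lemma wreath_one: "\<one>\<^bsub>wreath n r\<^esub> = (\<lambda>i\<in>{1..n}. 0, id)"
  by (auto simp: wreath_def semidirect_product_def sym_group_def intro!: restrict_ext)

text \<open>The residue part of the inverse is minus \<open>x\<close> moved by the inverse of
  \<open>u\<close>. As the action evaluates at the inverse permutation, \<open>u\<close> itself
  appears inside \<open>x\<close>.\<close>

lemma wreath_left_inverse:
  assumes "(x, u) \<in> carrier (wreath n r)" "0 < r"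
  shows "(\<lambda>i\<in>{1..n}. - x (u i) mod int r, inv' u) \<in> carrier (wreath n r)"
    and "(\<lambda>i\<in>{1..n}. - x (u i) mod int r, inv' u) \<otimes>\<^bsub>wreath n r\<^esub> (x, u) = \<one>\<^bsub>wreath n r\<^esub>"
  using assms
  by (auto simp: wreath_carrier wreath_mult wreath_one permutes_inv permutes_inv_o permutes_inv_inv
      mod_add_left_eq intro!: restrict_ext)

lemma group_wreath:
  assumes r: "0 < r"
  shows "group (wreath n r)"
proof (rule groupI)
  note [simp] = wreath_carrier[OF r]
  fix g h assume "g \<in> carrier (wreath n r)" "h \<in> carrier (wreath n r)"
  then show "g \<otimes>\<^bsub>wreath n r\<^esub> h \<in> carrier (wreath n r)"
    using r by (cases g; cases h) (auto simp: wreath_mult permutes_compose)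
next
  show "\<one>\<^bsub>wreath n r\<^esub> \<in> carrier (wreath n r)"
    using r by (auto simp: wreath_carrier wreath_one permutes_id)
next
  fix g h k
  assume "g \<in> carrier (wreath n r)" "h \<in> carrier (wreath n r)" "k \<in> carrier (wreath n r)"
  moreover obtain x u y v z w where "g = (x, u)" "h = (y, v)" "k = (z, w)"
    by (metis surj_pair)
  ultimately have g: "g = (x, u)" "h = (y, v)" "k = (z, w)"
    and u: "u permutes {1..n}" and v: "v permutes {1..n}"
    using r by (auto simp: wreath_carrier)
  have "inv' u i \<in> {1..n}" if "i \<in> {1..n}" for i
    using permutes_in_image[OF permutes_inv[OF u]] that by blast
  moreover have "inv' (u \<circ> v) = inv' v \<circ> inv' u"
    by (rule o_inv_distrib) (use u v permutes_bij in auto)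
  ultimately show "g \<otimes>\<^bsub>wreath n r\<^esub> h \<otimes>\<^bsub>wreath n r\<^esub> k = g \<otimes>\<^bsub>wreath n r\<^esub> (h \<otimes>\<^bsub>wreath n r\<^esub> k)"
    by (auto simp: g wreath_mult mod_simps add.assoc comp_assoc intro!: restrict_ext)
next
  fix g assume "g \<in> carrier (wreath n r)"
  then obtain x u where g: "g = (x, u)" and x: "x \<in> {1..n} \<rightarrow>\<^sub>E {0..<int r}"
    using r by (auto simp: wreath_carrier)
  have "x i mod int r = x i" if "i \<in> {1..n}" for i
    using PiE_mem[OF x that] by simp
  then show "\<one>\<^bsub>wreath n r\<^esub> \<otimes>\<^bsub>wreath n r\<^esub> g = g"
    using PiE_restrict[OF x] by (simp add: g wreath_one wreath_mult cong: restrict_cong)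
next
  fix g assume "g \<in> carrier (wreath n r)"
  then show "\<exists>h\<in>carrier (wreath n r). h \<otimes>\<^bsub>wreath n r\<^esub> g = \<one>\<^bsub>wreath n r\<^esub>"
    using wreath_left_inverse[of "fst g" "snd g" n r] r by auto
qed

lemma wreath_inv:
  assumes "(x, u) \<in> carrier (wreath n r)" "0 < r"
  shows "inv\<^bsub>wreath n r\<^esub> (x, u) = (\<lambda>i\<in>{1..n}. - x (u i) mod int r, inv' u)"
  using group.inv_equality[OF group_wreath] wreath_left_inverse[OF assms] assms by blast

lemma finite_wreath: "0 < r \<Longrightarrow> finite (carrier (wreath n r))"
  by (auto simp: wreath_carrier finite_permutations intro!: finite_PiE)

section \<open>Block subgroups\<close>

lemma block_subset: "k < length as \<Longrightarrow> block as k \<subseteq> {1..sum_list as}"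
  using sum_list_take_mono[of "Suc k" "length as" as]
  by (auto simp: block_def block_offset_def take_Suc_conv_app_nth)

text \<open>The block condition restricts the permutation only, so the block subgroup is a full
  product and its order splits off the factor \<open>r ^ n\<close>.\<close>

definition block_perms :: "nat \<Rightarrow> nat list \<Rightarrow> (nat \<Rightarrow> nat) set" where
  "block_perms n as = {w. w permutes {1..n} \<and> (\<forall>k<length as. w ` block as k = block as k)}"

lemma block_subgroup_eq:
  "0 < r \<Longrightarrow> block_subgroup n r as = ({1..n} \<rightarrow>\<^sub>E {0..<int r}) \<times> block_perms n as"
  by (intro Set.set_eqI) (auto simp only: block_subgroup_def block_perms_def wreath_carrier mem_Times_iff mem_Collect_eq)

lemma subgroup_block_subgroup:
  assumes r: "0 < r"
  shows "subgroup (block_subgroup n r as) (wreath n r)"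
proof -
  interpret group "wreath n r"
    by (rule group_wreath[OF r])
  show ?thesis
  proof (rule subgroupI)
    show "block_subgroup n r as \<subseteq> carrier (wreath n r)"
      by (auto simp: block_subgroup_def)
    have "\<one>\<^bsub>wreath n r\<^esub> \<in> block_subgroup n r as"
      using one_closed by (simp add: block_subgroup_def) (simp add: wreath_one)
    then show "block_subgroup n r as \<noteq> {}"
      by blast
  next
    fix g assume g: "g \<in> block_subgroup n r as"
    obtain x u where xu: "g = (x, u)"
      by (cases g)
    have G: "(x, u) \<in> carrier (wreath n r)" and u: "u permutes {1..n}"
      using g xu by (auto simp: block_subgroup_def wreath_carrier[OF r])
    have "inv' u ` block as k = block as k" if "k < length as" for k
    proof -
      have "inv' u ` (u ` block as k) = block as k"
        using permutes_inv_o(2)[OF u] by (simp add: image_comp)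
      then show ?thesis
        using g that by (simp add: xu block_subgroup_def)
    qed
    then show "inv\<^bsub>wreath n r\<^esub> g \<in> block_subgroup n r as"
      using inv_closed[OF G] by (simp add: xu block_subgroup_def wreath_inv[OF G r])
  next
    fix g h assume gh: "g \<in> block_subgroup n r as" "h \<in> block_subgroup n r as"
    then have "g \<otimes>\<^bsub>wreath n r\<^esub> h \<in> carrier (wreath n r)"
      by (auto simp: block_subgroup_def)
    then show "g \<otimes>\<^bsub>wreath n r\<^esub> h \<in> block_subgroup n r as"
      using gh by (cases g; cases h) (auto simp: block_subgroup_def wreath_mult simp flip: image_image)
  qed
qed

section \<open>The character \<open>\<zeta>\<close> on the whole group and on single blocks\<close>

lemma power_int_root_of_unity_mod:
  fixes \<zeta> :: complex
  assumes "\<zeta> ^ r = 1" "0 < r"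
  shows "\<zeta> powi (a mod int r) = \<zeta> powi a"
proof -
  have nz: "\<zeta> \<noteq> 0"
    using assms by (auto simp: power_0_left)
  have "\<zeta> powi a = \<zeta> powi (int r * (a div int r) + a mod int r)"
    by simp
  also have "\<dots> = (\<zeta> powi int r) powi (a div int r) * \<zeta> powi (a mod int r)"
    by (subst power_int_add) (simp only: nz simp_thms, simp only: power_int_mult)
  finally show ?thesis
    using assms by simp
qed

text \<open>A permutation that preserves \<open>I\<close> merely rearranges the second sum. The case
  \<open>{1..n}\<close> makes \<open>zeta_char\<close> multiplicative, the case of a block does so
  for the twist of one factor.\<close>

lemma power_int_sum_wreath_mult:
  fixes \<zeta> :: complex
  assumes \<zeta>: "\<zeta> ^ r = 1" "0 < r" and u: "u permutes {1..n}" and I: "u ` I = I" "I \<subseteq> {1..n}"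
  shows "\<zeta> powi (\<Sum>i\<in>I. fst ((x, u) \<otimes>\<^bsub>wreath n r\<^esub> (y, v)) i) = \<zeta> powi (\<Sum>i\<in>I. x i) * \<zeta> powi (\<Sum>i\<in>I. y i)"
proof -
  have nz: "\<zeta> \<noteq> 0"
    using \<zeta> by (auto simp: power_0_left)
  have "(\<Sum>i\<in>I. y (inv' u i)) = (\<Sum>i\<in>u ` I. y (inv' u i))"
    by (simp add: I)
  also have "\<dots> = (\<Sum>i\<in>I. y i)"
    using permutes_inj[OF u] by (subst sum.reindex) (auto simp: permutes_inverses(2)[OF u] intro: inj_on_subset)
  finally have y: "(\<Sum>i\<in>I. y (inv' u i)) = (\<Sum>i\<in>I. y i)" .
  have "(\<Sum>i\<in>I. fst ((x, u) \<otimes>\<^bsub>wreath n r\<^esub> (y, v)) i) = (\<Sum>i\<in>I. (x i + y (inv' u i)) mod int r)"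
    using I by (intro sum.cong) (auto simp: wreath_mult)
  then have "\<zeta> powi (\<Sum>i\<in>I. fst ((x, u) \<otimes>\<^bsub>wreath n r\<^esub> (y, v)) i) =
      \<zeta> powi ((\<Sum>i\<in>I. (x i + y (inv' u i)) mod int r) mod int r)"
    by (simp add: power_int_root_of_unity_mod[OF \<zeta>])
  also have "\<dots> = \<zeta> powi (\<Sum>i\<in>I. x i + y (inv' u i))"
    by (simp add: mod_sum_eq power_int_root_of_unity_mod[OF \<zeta>])
  finally show ?thesis
    using nz by (simp add: sum.distrib y power_int_add)
qed

lemma zeta_char_mult:
  assumes "\<zeta> ^ r = 1" "0 < r" "g \<in> carrier (wreath n r)" "h \<in> carrier (wreath n r)"
  shows "zeta_char \<zeta> n (g \<otimes>\<^bsub>wreath n r\<^esub> h) = zeta_char \<zeta> n g * zeta_char \<zeta> n h"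
  using assms power_int_sum_wreath_mult[OF assms(1,2), of "snd g" n "{1..n}" "fst g" "fst h" "snd h"]
  by (cases g; cases h) (auto simp: zeta_char_def wreath_carrier permutes_image split: prod.split)

lemma zeta_char_nonzero: "\<zeta> \<noteq> 0 \<Longrightarrow> zeta_char \<zeta> n g \<noteq> 0"
  by (auto simp: zeta_char_def power_int_not_zero split: prod.split)

lemma zeta_char_power:
  assumes "\<zeta> ^ r = 1"
  shows "zeta_char \<zeta> n g ^ r = 1"
proof -
  obtain x w where "g = (x, w)"
    by (cases g)
  then have "zeta_char \<zeta> n g ^ r = (\<zeta> powi (\<Sum>i\<in>{1..n}. x i)) powi int r"
    by (simp add: zeta_char_def)
  also have "\<dots> = (\<zeta> powi int r) powi (\<Sum>i\<in>{1..n}. x i)"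
    by (simp only: mult.commute flip: power_int_mult)
  finally have "zeta_char \<zeta> n g ^ r = (\<zeta> powi int r) powi (\<Sum>i\<in>{1..n}. x i)" .
  then show ?thesis
    using assms by simp
qed

lemma zeta_char_block_component:
  "zeta_char \<zeta> (as ! k) (block_component as k (x, w)) = \<zeta> powi (\<Sum>i\<in>block as k. x i)"
proof -
  have "(\<Sum>i\<in>{1..as ! k}. x (block_offset as k + i)) = (\<Sum>i\<in>block as k. x i)"
    by (rule sum.reindex_bij_witness[of _ "\<lambda>i. i - block_offset as k" "\<lambda>i. block_offset as k + i"])
      (auto simp: block_def)
  then show ?thesis
    by (simp add: zeta_char_def block_component_def)
qed

lemma block_iff: "j \<in> block as k \<longleftrightarrow> (\<exists>i\<in>{1..as ! k}. j = block_offset as k + i)"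
  by (auto simp: block_def intro!: bexI[of _ "j - block_offset as k"])

lemma snd_block_component:
  "snd (block_component as k (x, w)) =
    (\<lambda>i. if i \<in> {1..as ! k} then w (block_offset as k + i) - block_offset as k else i)"
  by (simp add: block_component_def)

lemma block_component_permutes:
  assumes w: "w permutes {1..n}" and B: "w ` block as k = block as k"
  shows "snd (block_component as k (x, w)) permutes {1..as ! k}"
proof -
  let ?b = "snd (block_component as k (x, w))" and ?o = "block_offset as k"
  \<comment> \<open>As the block is preserved, \<open>w\<close> stays above the offset and the
    subtraction in \<open>block_component\<close> is not truncated.\<close>
  have b: "?b i \<in> {1..as ! k} \<and> w (?o + i) = ?o + ?b i" if i: "i \<in> {1..as ! k}" for i
  proof -
    have "w (?o + i) \<in> w ` block as k"
      using i by (intro imageI) (auto simp: block_iff)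
    then obtain j where "j \<in> {1..as ! k}" "w (?o + i) = ?o + j"
      unfolding B block_iff by blast
    then show ?thesis
      using i by (simp add: snd_block_component)
  qed
  have "inj_on ?b {1..as ! k}"
  proof (rule inj_onI)
    fix i j assume ij: "i \<in> {1..as ! k}" "j \<in> {1..as ! k}" "?b i = ?b j"
    then have "w (?o + i) = w (?o + j)"
      using b[OF ij(1)] b[OF ij(2)] by simp
    then show "i = j"
      by (simp add: inj_eq[OF permutes_inj[OF w]])
  qed
  moreover have "?b ` {1..as ! k} \<subseteq> {1..as ! k}"
    using b by blast
  ultimately have "bij_betw ?b {1..as ! k} {1..as ! k}"
    by (simp add: bij_betw_def endo_inj_surj)
  then show ?thesis
    by (rule bij_imp_permutes) (simp only: snd_block_component if_False)
qed

lemma snd_block_component_mult: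
  assumes B: "v ` block as k = block as k"
  shows "snd (block_component as k ((x, w) \<otimes>\<^bsub>wreath n r\<^esub> (y, v))) =
    snd (block_component as k (x, w)) \<circ> snd (block_component as k (y, v))"
proof
  fix i
  show "snd (block_component as k ((x, w) \<otimes>\<^bsub>wreath n r\<^esub> (y, v))) i =
    (snd (block_component as k (x, w)) \<circ> snd (block_component as k (y, v))) i"
  proof (cases "i \<in> {1..as ! k}")
    case True
    then have "v (block_offset as k + i) \<in> v ` block as k"
      by (intro imageI) (auto simp: block_iff)
    then obtain j where "j \<in> {1..as ! k}" "v (block_offset as k + i) = block_offset as k + j"
      unfolding B block_iff by blast
    then show ?thesis
      using True by (simp add: wreath_mult snd_block_component)
  next
    case False
    then show ?thesis
      by (simp only: wreath_mult snd_block_component comp_def if_False)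
  qed
qed

lemma snd_block_component_one: "snd (block_component as k \<one>\<^bsub>wreath n r\<^esub>) = id"
  by (auto simp: wreath_one snd_block_component)

text \<open>Appending a block leaves the offsets of the earlier ones alone, hence the induction from
  the right.\<close>

lemma power_int_sum_blocks:
  fixes \<zeta> :: complex
  assumes "\<zeta> \<noteq> 0"
  shows "prod_list (map (\<lambda>k. \<zeta> powi (\<Sum>i\<in>block as k. x i)) [0..<length as]) = \<zeta> powi (\<Sum>i\<in>{1..sum_list as}. x i)"
proof (induction as rule: rev_induct)
  case (snoc a as)
  have "block (as @ [a]) k = block as k" if "k < length as" for k
    using that by (simp add: block_def block_offset_def nth_append)
  then have "prod_list (map (\<lambda>k. \<zeta> powi (\<Sum>i\<in>block (as @ [a]) k. x i)) [0..<length as]) =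
      prod_list (map (\<lambda>k. \<zeta> powi (\<Sum>i\<in>block as k. x i)) [0..<length as])"
    by (intro arg_cong[of _ _ prod_list] map_cong) simp_all
  moreover have "block (as @ [a]) (length as) = {sum_list as + 1..sum_list as + a}"
    by (simp add: block_def block_offset_def)
  moreover have "(\<Sum>i\<in>{1..sum_list as + a}. x i) =
      (\<Sum>i\<in>{1..sum_list as}. x i) + (\<Sum>i\<in>{sum_list as + 1..sum_list as + a}. x i)"
    by (subst sum.union_disjoint[symmetric]) (auto intro!: sum.cong)
  ultimately show ?case
    using snoc assms by (simp add: power_int_add)
qed simp

section \<open>Rotating multipartitions\<close>

lemma smult_smult_mat: "a \<cdot>\<^sub>m (b \<cdot>\<^sub>m A) = (a * b) \<cdot>\<^sub>m A" for A :: "'a::semigroup_mult mat"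
  by (rule eq_matI) (simp_all add: mult.assoc)

lemma smult_mult_smult_mat:
  fixes A B :: "'a::comm_ring_1 mat"
  assumes "A \<in> carrier_mat m k" "B \<in> carrier_mat k n"
  shows "(a \<cdot>\<^sub>m A) * (b \<cdot>\<^sub>m B) = (a * b) \<cdot>\<^sub>m (A * B)"
  using mult_smult_assoc_mat[OF assms(1), of "b \<cdot>\<^sub>m B" n a] mult_smult_distrib[OF assms, of b] assms(2)
  by (simp add: smult_smult_mat)

definition block_rep :: "complex \<Rightarrow> nat list list \<Rightarrow> wreath_elem \<Rightarrow> complex mat" where
  "block_rep \<zeta> \<Lambda> h = kronecker_list
     (map (\<lambda>k. twisted_specht_rep \<zeta> k (\<Lambda> ! k) (block_component (map sum_list \<Lambda>) k h)) [0..<length \<Lambda>])"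

definition block_dim :: "nat list list \<Rightarrow> nat" where
  "block_dim \<Lambda> = prod_list (map specht_dim \<Lambda>)"

lemma block_dim_eq: "block_dim \<Lambda> = prod_list (map (\<lambda>k. specht_dim (\<Lambda> ! k)) [0..<length \<Lambda>])"
proof -
  have "map specht_dim \<Lambda> = map (\<lambda>k. specht_dim (\<Lambda> ! k)) [0..<length \<Lambda>]"
    by (rule nth_equalityI) simp_all
  then show ?thesis
    by (simp add: block_dim_def)
qed

lemma wreath_irrep_eq:
  "length \<Lambda> = r \<Longrightarrow> wreath_irrep \<zeta> n r \<Lambda> =
    induced_rep (wreath n r) (block_subgroup n r (map sum_list \<Lambda>)) (block_rep \<zeta> \<Lambda>)"
  by (auto simp: wreath_irrep_def block_rep_def[abs_def] Let_def)

lemma twisted_specht_rep_carrier: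
  "twisted_specht_rep \<zeta> k \<mu> g \<in> carrier_mat (specht_dim \<mu>) (specht_dim \<mu>)"
  using specht_rep_carrier by (simp add: twisted_specht_rep_def)

lemma block_rep_carrier: "block_rep \<zeta> \<Lambda> h \<in> carrier_mat (block_dim \<Lambda>) (block_dim \<Lambda>)"
  unfolding block_rep_def block_dim_eq by (rule kronecker_list_carrier) (rule twisted_specht_rep_carrier)

lemma matrix_subgroup_rep_block_rep:
  assumes \<zeta>: "\<zeta> ^ r = 1" and r: "0 < r"
    and n: "sum_list (map sum_list \<Lambda>) = n"
  shows "matrix_subgroup_rep (wreath n r) (block_subgroup n r (map sum_list \<Lambda>)) (block_rep \<zeta> \<Lambda>) (block_dim \<Lambda>)"
proof -
  define as where "as = map sum_list \<Lambda>"
  interpret group "wreath n r"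
    by (rule group_wreath[OF r])
  have sub: "block as k \<subseteq> {1..n}" if "k < length \<Lambda>" for k
    using block_subset[of k as] that n by (simp add: as_def)
  show ?thesis
    unfolding as_def[symmetric]
  proof (intro matrix_subgroup_rep.intro matrix_subgroup_rep_axioms.intro)
    show "group (wreath n r)"
      by (rule group_wreath[OF r])
    show "finite (carrier (wreath n r))"
      by (rule finite_wreath[OF r])
    show "subgroup (block_subgroup n r as) (wreath n r)"
      by (rule subgroup_block_subgroup[OF r])
    show "block_rep \<zeta> \<Lambda> h \<in> carrier_mat (block_dim \<Lambda>) (block_dim \<Lambda>)" for h
      by (rule block_rep_carrier)
    have "twisted_specht_rep \<zeta> k (\<Lambda> ! k) (block_component as k \<one>\<^bsub>wreath n r\<^esub>) = 1\<^sub>m (specht_dim (\<Lambda> ! k))"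
      if k: "k < length \<Lambda>" for k
    proof -
      have "(\<Sum>i\<in>block as k. fst \<one>\<^bsub>wreath n r\<^esub> i) = 0"
        using sub[OF k] by (intro sum.neutral) (auto simp: wreath_one)
      then have "zeta_char \<zeta> (sum_list (\<Lambda> ! k)) (block_component as k \<one>\<^bsub>wreath n r\<^esub>) = 1"
        using zeta_char_block_component[of \<zeta> as k "fst \<one>\<^bsub>wreath n r\<^esub>" "snd \<one>\<^bsub>wreath n r\<^esub>"] k
        by (simp add: as_def)
      then show ?thesis
        by (auto simp: twisted_specht_rep_def snd_block_component_one specht_rep_id intro!: eq_matI)
    qed
    then have "map (\<lambda>k. twisted_specht_rep \<zeta> k (\<Lambda> ! k) (block_component as k \<one>\<^bsub>wreath n r\<^esub>)) [0..<length \<Lambda>] =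
        map (\<lambda>k. 1\<^sub>m (specht_dim (\<Lambda> ! k))) [0..<length \<Lambda>]"
      by simp
    then show "block_rep \<zeta> \<Lambda> \<one>\<^bsub>wreath n r\<^esub> = 1\<^sub>m (block_dim \<Lambda>)"
      unfolding block_rep_def as_def[symmetric] block_dim_eq by (simp only: kronecker_list_one)
  next
    fix g h assume gh: "g \<in> block_subgroup n r as" "h \<in> block_subgroup n r as"
    obtain x u y v where xy: "g = (x, u)" "h = (y, v)"
      by (metis surj_pair)
    have u: "u permutes {1..n}" and v: "v permutes {1..n}"
      using gh by (auto simp: xy block_subgroup_def wreath_carrier[OF r])
    have B: "u ` block as k = block as k" "v ` block as k = block as k" if "k < length \<Lambda>" for k
      using gh that by (auto simp: xy block_subgroup_def as_def)
    have "twisted_specht_rep \<zeta> k (\<Lambda> ! k) (block_component as k (g \<otimes>\<^bsub>wreath n r\<^esub> h)) =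
        twisted_specht_rep \<zeta> k (\<Lambda> ! k) (block_component as k g) * twisted_specht_rep \<zeta> k (\<Lambda> ! k) (block_component as k h)"
      if k: "k < length \<Lambda>" for k
    proof -
      have ask: "as ! k = sum_list (\<Lambda> ! k)"
        using k by (simp add: as_def)
      have z: "zeta_char \<zeta> (as ! k) (block_component as k (g \<otimes>\<^bsub>wreath n r\<^esub> h)) =
          zeta_char \<zeta> (as ! k) (block_component as k g) * zeta_char \<zeta> (as ! k) (block_component as k h)"
        using power_int_sum_wreath_mult[OF \<zeta> r u B(1)[OF k] sub[OF k], of x y v]
          zeta_char_block_component[of \<zeta> as k "fst (g \<otimes>\<^bsub>wreath n r\<^esub> h)" "snd (g \<otimes>\<^bsub>wreath n r\<^esub> h)"]
        by (simp add: xy zeta_char_block_component)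
      have "specht_rep (\<Lambda> ! k) (snd (block_component as k (g \<otimes>\<^bsub>wreath n r\<^esub> h))) =
          specht_rep (\<Lambda> ! k) (snd (block_component as k g)) * specht_rep (\<Lambda> ! k) (snd (block_component as k h))"
        unfolding xy snd_block_component_mult[OF B(2)[OF k]]
        by (intro specht_rep_mult)
          (use block_component_permutes[OF u B(1)[OF k]] block_component_permutes[OF v B(2)[OF k]] in \<open>simp_all add: ask\<close>)
      then show ?thesis
        using smult_mult_smult_mat[OF specht_rep_carrier[of "\<Lambda> ! k"] specht_rep_carrier[of "\<Lambda> ! k"]] z
        by (simp add: twisted_specht_rep_def ask power_mult_distrib)
    qed
    then have "block_rep \<zeta> \<Lambda> (g \<otimes>\<^bsub>wreath n r\<^esub> h) = kronecker_list (map (\<lambda>k.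
        twisted_specht_rep \<zeta> k (\<Lambda> ! k) (block_component as k g) * twisted_specht_rep \<zeta> k (\<Lambda> ! k) (block_component as k h)) [0..<length \<Lambda>])"
      unfolding block_rep_def as_def[symmetric] by (intro arg_cong[of _ _ kronecker_list] map_cong) simp_all
    also have "\<dots> = block_rep \<zeta> \<Lambda> g * block_rep \<zeta> \<Lambda> h"
      unfolding block_rep_def as_def[symmetric]
      by (rule kronecker_list_mult) (rule twisted_specht_rep_carrier)+
    finally show "block_rep \<zeta> \<Lambda> (g \<otimes>\<^bsub>wreath n r\<^esub> h) = block_rep \<zeta> \<Lambda> g * block_rep \<zeta> \<Lambda> h" .
  qed
qed

section \<open>Conjugation by the permutation that moves the first block to the end\<close>

definition block_shift :: "nat \<Rightarrow> nat \<Rightarrow> nat \<Rightarrow> nat" where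
  "block_shift a b i = (if i \<in> {1..a} then i + b else if i \<in> {a + 1..a + b} then i - a else i)"

lemma block_shift_permutes: "block_shift a b permutes {1..a + b}"
proof (rule bij_imp_permutes)
  show "bij_betw (block_shift a b) {1..a + b} {1..a + b}"
    by (rule bij_betw_byWitness[where f' = "block_shift b a"]) (auto simp: block_shift_def)
qed (auto simp: block_shift_def)

text \<open>The place to which \<open>rotate1\<close> moves component \<open>k\<close> of a list of
  length \<open>q + 1\<close>.\<close>

definition rotated_index :: "nat \<Rightarrow> nat \<Rightarrow> nat" where
  "rotated_index q k = (case k of 0 \<Rightarrow> q | Suc j \<Rightarrow> j)"

text \<open>Each block is translated as a whole, so the numbering inside the blocks is kept.\<close>

lemma block_shift_block:
  assumes "k \<le> length bs"
  shows "(bs @ [a]) ! rotated_index (length bs) k = (a # bs) ! k"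
    and "i \<in> {1..(a # bs) ! k} \<Longrightarrow>
      block_shift a (sum_list bs) (block_offset (a # bs) k + i) =
      block_offset (bs @ [a]) (rotated_index (length bs) k) + i"
proof -
  show nth: "(bs @ [a]) ! rotated_index (length bs) k = (a # bs) ! k"
    using assms by (cases k) (auto simp: rotated_index_def nth_append)
  assume i: "i \<in> {1..(a # bs) ! k}"
  show "block_shift a (sum_list bs) (block_offset (a # bs) k + i) =
      block_offset (bs @ [a]) (rotated_index (length bs) k) + i"
  proof (cases k)
    case (Suc j)
    then have "sum_list (take j bs) + i \<le> sum_list (take (Suc j) bs)"
      using i assms by (simp add: take_Suc_conv_app_nth)
    also have "\<dots> \<le> sum_list (take (length bs) bs)"
      by (rule sum_list_take_mono) (use assms Suc in simp)
    finally show ?thesis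
      using i Suc assms by (auto simp: block_shift_def block_offset_def rotated_index_def)
  qed (use i in \<open>auto simp: block_shift_def block_offset_def rotated_index_def\<close>)
qed

lemma wreath_conjugate:
  assumes r: "0 < r" and c: "c permutes {1..n}" and xw: "(x, w) \<in> carrier (wreath n r)"
  shows "((\<lambda>i\<in>{1..n}. 0), c) \<otimes>\<^bsub>wreath n r\<^esub> (x, w) \<otimes>\<^bsub>wreath n r\<^esub> inv\<^bsub>wreath n r\<^esub> ((\<lambda>i\<in>{1..n}. 0), c) =
    (\<lambda>i\<in>{1..n}. x (inv' c i), c \<circ> w \<circ> inv' c)" (is "?u \<otimes>\<^bsub>_\<^esub> _ \<otimes>\<^bsub>_\<^esub> _ = ?h")
proof -
  interpret group "wreath n r"
    by (rule group_wreath[OF r])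
  have u: "?u \<in> carrier (wreath n r)"
    using r c by (auto simp: wreath_carrier)
  have ci: "inv' c i \<in> {1..n}" if "i \<in> {1..n}" for i
    using permutes_in_image[OF permutes_inv[OF c]] that by blast
  have x: "x \<in> {1..n} \<rightarrow>\<^sub>E {0..<int r}" and w: "w permutes {1..n}"
    using xw r by (auto simp: wreath_carrier)
  have "(\<lambda>i\<in>{1..n}. x (inv' c i)) \<in> {1..n} \<rightarrow>\<^sub>E {0..<int r}"
    using PiE_mem[OF x ci] by auto
  moreover have "c \<circ> w \<circ> inv' c permutes {1..n}"
    by (intro permutes_compose permutes_inv c w)
  ultimately have h: "?h \<in> carrier (wreath n r)"
    using r by (simp add: wreath_carrier)
  have "inv' (c \<circ> w \<circ> inv' c) i \<in> {1..n}" if "i \<in> {1..n}" for i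
    using permutes_in_image[OF permutes_inv[OF \<open>c \<circ> w \<circ> inv' c permutes {1..n}\<close>]] that by blast
  \<comment> \<open>Comparing these two products avoids an explicit inverse of \<open>u\<close>;
    both are reduced modulo \<open>r\<close> in the same way.\<close>
  then have "?u \<otimes>\<^bsub>wreath n r\<^esub> (x, w) = ?h \<otimes>\<^bsub>wreath n r\<^esub> ?u"
    using permutes_inv_o(2)[OF c] by (auto simp: wreath_mult comp_assoc intro!: restrict_ext)
  then show ?thesis
    using u h xw inv_solve_right[OF h] by (simp add: m_assoc)
qed

text \<open>\<open>c\<close> translates block \<open>k\<close> onto block \<open>k'\<close>, and the
  renumbering in \<open>block_component\<close> forgets exactly this translation.\<close>

lemma block_component_conjugate:
  assumes c: "c permutes {1..n}" and w: "w ` block as k = block as k"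
    and k: "k < length as" "sum_list as = n" "k' < length as'" "sum_list as' = n"
    and len: "as' ! k' = as ! k"
    and shift: "\<And>i. i \<in> {1..as ! k} \<Longrightarrow> c (block_offset as k + i) = block_offset as' k' + i"
  shows "block_component as' k' (\<lambda>i\<in>{1..n}. x (inv' c i), c \<circ> w \<circ> inv' c) = block_component as k (x, w)"
proof -
  have inv: "inv' c (block_offset as' k' + i) = block_offset as k + i" if "i \<in> {1..as ! k}" for i
    using shift[OF that] permutes_inverses(2)[OF c] by metis
  have mem: "block_offset as' k' + i \<in> {1..n}" if "i \<in> {1..as ! k}" for i
    using block_subset[OF k(3)] that len k(4) by (auto simp: block_def)
  have cw: "c (w (block_offset as k + i)) - block_offset as' k' = w (block_offset as k + i) - block_offset as k"
    if "i \<in> {1..as ! k}" for i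
  proof -
    have "w (block_offset as k + i) \<in> w ` block as k"
      using that by (intro imageI) (auto simp: block_iff)
    then obtain j where "j \<in> {1..as ! k}" "w (block_offset as k + i) = block_offset as k + j"
      unfolding w block_iff by blast
    then show ?thesis
      using shift by simp
  qed
  show ?thesis
    unfolding block_component_def prod.case len
    using inv mem cw by (auto simp: fun_eq_iff restrict_def)
qed

text \<open>Supplies the data for \<open>det_induced_rep_conjugate\<close>: \<open>u\<close> is the
  block shift with zero residues, \<open>\<sigma>\<close> the shuffle that moves the first Kronecker
  factor to the end.\<close>

lemma block_rep_rotate:
  assumes \<zeta>: "\<zeta> ^ r = 1" and r: "length \<Lambda> = r" "0 < r"
    and n: "sum_list (map sum_list \<Lambda>) = n"
  shows "\<exists>u \<sigma>. u \<in> carrier (wreath n r) \<and>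
    (\<forall>h\<in>carrier (wreath n r). h \<in> block_subgroup n r (map sum_list \<Lambda>) \<longleftrightarrow>
      u \<otimes>\<^bsub>wreath n r\<^esub> h \<otimes>\<^bsub>wreath n r\<^esub> inv\<^bsub>wreath n r\<^esub> u \<in> block_subgroup n r (map sum_list (rotate1 \<Lambda>))) \<and>
    inj_on \<sigma> {..<block_dim \<Lambda>} \<and> (\<forall>p<block_dim \<Lambda>. \<sigma> p < block_dim \<Lambda>) \<and>
    (\<forall>h\<in>block_subgroup n r (map sum_list \<Lambda>). \<forall>p<block_dim \<Lambda>. \<forall>q<block_dim \<Lambda>.
      block_rep \<zeta> \<Lambda> h $$ (p, q) = zeta_char \<zeta> n h *
        block_rep \<zeta> (rotate1 \<Lambda>) (u \<otimes>\<^bsub>wreath n r\<^esub> h \<otimes>\<^bsub>wreath n r\<^esub> inv\<^bsub>wreath n r\<^esub> u) $$ (\<sigma> p, \<sigma> q))"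
proof -
  obtain \<mu> M where \<Lambda>: "\<Lambda> = \<mu> # M"
    using r by (cases \<Lambda>) auto
  define q where "q = length M"
  define a where "a = sum_list \<mu>"
  define bs where "bs = map sum_list M"
  define as where "as = a # bs"
  define as' where "as' = bs @ [a]"
  have as: "map sum_list \<Lambda> = as" "map sum_list (rotate1 \<Lambda>) = as'" "rotate1 \<Lambda> = M @ [\<mu>]"
    by (simp_all add: \<Lambda> as_def as'_def a_def bs_def)
  have len: "length bs = q" "r = Suc q" "length as = r" "length as' = r" "length \<Lambda> = r" "length (rotate1 \<Lambda>) = r"
    using r by (simp_all add: q_def bs_def as_def as'_def \<Lambda>)
  have sums: "a + sum_list bs = n" "sum_list as = n" "sum_list as' = n"
    using n by (simp_all add: \<Lambda> as_def as'_def a_def bs_def)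
  define c where "c = block_shift a (sum_list bs)"
  have c: "c permutes {1..n}"
    using block_shift_permutes[of a "sum_list bs"] by (simp add: c_def sums)
  define u :: wreath_elem where "u = ((\<lambda>i\<in>{1..n}. 0), c)"
  have u: "u \<in> carrier (wreath n r)"
    using r(2) c by (auto simp: u_def wreath_carrier)
  interpret group "wreath n r"
    by (rule group_wreath[OF r(2)])
  define cj where "cj h = u \<otimes>\<^bsub>wreath n r\<^esub> h \<otimes>\<^bsub>wreath n r\<^esub> inv\<^bsub>wreath n r\<^esub> u" for h
  have cj: "cj (x, w) = (\<lambda>i\<in>{1..n}. x (inv' c i), c \<circ> w \<circ> inv' c)" if "(x, w) \<in> carrier (wreath n r)" for x w
    using wreath_conjugate[OF r(2) c that] by (simp add: cj_def u_def)
  have nth: "as' ! rotated_index q k = as ! k"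
    and shift: "i \<in> {1..as ! k} \<Longrightarrow> c (block_offset as k + i) = block_offset as' (rotated_index q k) + i"
    if "k < r" for k i
    using block_shift_block(1)[of k bs a] block_shift_block(2)[of k bs i a] that unfolding c_def as_def as'_def by (simp_all add: len)
  have blocks: "block as' (rotated_index q k) = c ` block as k" if "k < r" for k
    using shift[OF that] nth[OF that] by (auto simp: block_iff image_iff Bex_def) metis+
  have rot: "rotated_index q k < r" if "k < r" for k
    using that len by (auto simp: rotated_index_def split: nat.split)
  have rot_surj: "\<exists>k<r. k' = rotated_index q k" if "k' < r" for k'
    using that len by (cases "k' = q") (auto simp: rotated_index_def intro: exI[of _ 0] exI[of _ "Suc k'"])
  have inv_c: "inv' c ` c ` A = A" for A
    using permutes_inv_o(2)[OF c] by (simp add: image_comp)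
  have mem: "h \<in> block_subgroup n r as \<longleftrightarrow> cj h \<in> block_subgroup n r as'" if h: "h \<in> carrier (wreath n r)" for h
  proof -
    obtain x w where xw: "h = (x, w)"
      by (cases h)
    have inj: "inj c"
      by (rule permutes_inj[OF c])
    have "(w ` block as k = block as k) \<longleftrightarrow>
        ((c \<circ> w \<circ> inv' c) ` block as' (rotated_index q k) = block as' (rotated_index q k))" if "k < r" for k
      unfolding blocks[OF that] image_comp[symmetric] inv_c by (simp add: inj_image_eq_iff[OF inj])
    then have "(\<forall>k<r. w ` block as k = block as k) \<longleftrightarrow> (\<forall>k<r. (c \<circ> w \<circ> inv' c) ` block as' k = block as' k)"
      using rot rot_surj by metis
    moreover have "cj h \<in> carrier (wreath n r)"
      using u h by (simp add: cj_def)
    ultimately show ?thesis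
      using h cj[OF h[unfolded xw]] by (simp add: xw block_subgroup_def len)
  qed
  define dA where "dA = specht_dim \<mu>"
  define dB where "dB = block_dim M"
  have dim: "block_dim \<Lambda> = dA * dB"
    by (simp add: block_dim_def \<Lambda> dA_def dB_def)
  have entry: "block_rep \<zeta> \<Lambda> h $$ (i, j) = zeta_char \<zeta> n h *
      block_rep \<zeta> (rotate1 \<Lambda>) (cj h) $$ (swap_factors dA dB i, swap_factors dA dB j)"
    if h: "h \<in> block_subgroup n r as" and ij: "i < dA * dB" "j < dA * dB" for h i j
  proof -
    obtain x w where xw: "h = (x, w)"
      by (cases h)
    have hG: "(x, w) \<in> carrier (wreath n r)" and wB: "\<And>k. k < r \<Longrightarrow> w ` block as k = block as k"
      using h by (auto simp: xw block_subgroup_def len)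
    have comp: "block_component as' (rotated_index q k) (cj h) = block_component as k h" if "k < r" for k
      unfolding xw cj[OF hG]
      by (rule block_component_conjugate[OF c wB[OF that]])
        (use that rot[OF that] nth[OF that] shift[OF that] sums in \<open>simp_all add: len\<close>)
    have comp_last: "block_component as' q (cj h) = block_component as 0 h"
      using comp[of 0] len by (simp add: rotated_index_def)
    have comp_Suc: "block_component as' k (cj h) = block_component as (Suc k) h" if "k < q" for k
      using comp[of "Suc k"] len that by (simp add: rotated_index_def)
    define z where "z k = zeta_char \<zeta> (as ! k) (block_component as k h)" for k
    define A where "A = twisted_specht_rep \<zeta> q \<mu> (block_component as 0 h)"
    define F where "F k = twisted_specht_rep \<zeta> k (M ! k) (block_component as (Suc k) h)" for k
    define B where "B = kronecker_list (map F [0..<q])"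
    have A_carr: "A \<in> carrier_mat dA dA"
      unfolding A_def dA_def by (rule twisted_specht_rep_carrier)
    have B_carr: "B \<in> carrier_mat dB dB"
      unfolding B_def dB_def block_dim_eq q_def[symmetric] F_def
      by (rule kronecker_list_carrier) (rule twisted_specht_rep_carrier)
    \<comment> \<open>The exponent is 0 in front and \<open>q = r - 1\<close> at the end. The factor
      \<open>z 0\<close> can still be split off because \<open>z 0 ^ r = 1\<close>.\<close>
    have first: "twisted_specht_rep \<zeta> 0 \<mu> (block_component as 0 h) = z 0 \<cdot>\<^sub>m A"
    proof -
      have "z 0 * z 0 ^ q = 1"
        using zeta_char_power[OF \<zeta>, of "as ! 0" "block_component as 0 h"] by (simp add: z_def len)
      moreover have "zeta_char \<zeta> (sum_list \<mu>) (block_component as 0 h) = z 0"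
        by (simp add: z_def as_def a_def)
      ultimately show ?thesis
        by (simp add: A_def twisted_specht_rep_def smult_smult_mat)
    qed
    have rest: "twisted_specht_rep \<zeta> (Suc k) (M ! k) (block_component as (Suc k) h) = z (Suc k) \<cdot>\<^sub>m F k" if "k < q" for k
    proof -
      have "zeta_char \<zeta> (sum_list (M ! k)) (block_component as (Suc k) h) = z (Suc k)"
        using that by (simp add: z_def as_def bs_def q_def)
      then show ?thesis
        by (simp add: F_def twisted_specht_rep_def smult_smult_mat)
    qed
    have tail: "map (\<lambda>k. twisted_specht_rep \<zeta> (Suc k) (M ! k) (block_component as (Suc k) h)) [0..<q] =
        map (\<lambda>k. z (Suc k) \<cdot>\<^sub>m F k) [0..<q]"
      by (rule map_cong) (simp_all add: rest)
    have upt: "[0..<r] = 0 # map Suc [0..<q]"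
      unfolding len(2) by (simp add: map_Suc_upt upt_conv_Cons)
    have "block_rep \<zeta> \<Lambda> h = kronecker (z 0 \<cdot>\<^sub>m A) (kronecker_list (map (\<lambda>k. z (Suc k) \<cdot>\<^sub>m F k) [0..<q]))"
      unfolding block_rep_def as len(5) upt by (simp add: \<Lambda> first tail comp_def)
    also have "\<dots> = prod_list (map z [0..<r]) \<cdot>\<^sub>m kronecker A B"
      unfolding kronecker_list_smult kronecker_smult upt B_def by (simp add: comp_def)
    \<comment> \<open>The blocks exhaust \<open>{1..n}\<close>, so the characters of the block
      components multiply to that of \<open>h\<close>.\<close>
    also have "prod_list (map z [0..<r]) = zeta_char \<zeta> n h"
    proof -
      have "\<zeta> \<noteq> 0"
        using \<zeta> r(2) by (auto simp: power_0_left)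
      moreover have "z = (\<lambda>k. \<zeta> powi (\<Sum>i\<in>block as k. x i))"
        by (simp add: fun_eq_iff z_def xw zeta_char_block_component)
      ultimately show ?thesis
        using power_int_sum_blocks[of \<zeta> x as] by (simp add: len(3) sums(2) xw zeta_char_def)
    qed
    finally have L: "block_rep \<zeta> \<Lambda> h = zeta_char \<zeta> n h \<cdot>\<^sub>m kronecker A B" .
    have R: "block_rep \<zeta> (rotate1 \<Lambda>) (cj h) = kronecker B A"
    proof -
      have "map (\<lambda>k. twisted_specht_rep \<zeta> k ((M @ [\<mu>]) ! k) (block_component as' k (cj h))) [0..<q] = map F [0..<q]"
        by (rule map_cong) (simp_all add: comp_Suc F_def nth_append q_def)
      moreover have "(M @ [\<mu>]) ! q = \<mu>"
        by (simp add: q_def)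
      ultimately show ?thesis
        unfolding block_rep_def as(2) len(6) unfolding as(3) len(2)
        by (simp only: upt_Suc_append le0 map_append list.map kronecker_list_snoc comp_last B_def A_def)
    qed
    show ?thesis
      unfolding L R using ij kronecker_swap[OF A_carr B_carr ij] kronecker_carrier[OF A_carr B_carr] by simp
  qed
  show ?thesis
    unfolding as(1,2) dim
    using u mem entry inj_on_swap_factors[of dA dB] swap_factors_props(1)[of _ dA dB]
    by (intro exI[of _ u] exI[of _ "swap_factors dA dB"]) (auto simp: cj_def mult.commute)
qed

lemma det_wreath_irrep_rotate1:
  assumes \<zeta>: "\<zeta> ^ r = 1" and r: "length \<Lambda> = r" "0 < r"
    and n: "sum_list (map sum_list \<Lambda>) = n" and g: "g \<in> carrier (wreath n r)"
  shows "dim_row (wreath_irrep \<zeta> n r \<Lambda> g) = dim_row (wreath_irrep \<zeta> n r (rotate1 \<Lambda>) g)"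
    and "det (wreath_irrep \<zeta> n r \<Lambda> g) =
      zeta_char \<zeta> n g ^ dim_row (wreath_irrep \<zeta> n r \<Lambda> g) * det (wreath_irrep \<zeta> n r (rotate1 \<Lambda>) g)"
proof -
  interpret group "wreath n r"
    by (rule group_wreath[OF r(2)])
  obtain u \<sigma> where u: "u \<in> carrier (wreath n r)"
    and mem: "\<And>h. h \<in> carrier (wreath n r) \<Longrightarrow> h \<in> block_subgroup n r (map sum_list \<Lambda>) \<longleftrightarrow>
      u \<otimes>\<^bsub>wreath n r\<^esub> h \<otimes>\<^bsub>wreath n r\<^esub> inv\<^bsub>wreath n r\<^esub> u \<in> block_subgroup n r (map sum_list (rotate1 \<Lambda>))"
    and \<sigma>: "inj_on \<sigma> {..<block_dim \<Lambda>}" "\<And>p. p < block_dim \<Lambda> \<Longrightarrow> \<sigma> p < block_dim \<Lambda>"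
    and entry: "\<And>h p q. h \<in> block_subgroup n r (map sum_list \<Lambda>) \<Longrightarrow> p < block_dim \<Lambda> \<Longrightarrow> q < block_dim \<Lambda> \<Longrightarrow>
      block_rep \<zeta> \<Lambda> h $$ (p, q) = zeta_char \<zeta> n h *
        block_rep \<zeta> (rotate1 \<Lambda>) (u \<otimes>\<^bsub>wreath n r\<^esub> h \<otimes>\<^bsub>wreath n r\<^esub> inv\<^bsub>wreath n r\<^esub> u) $$ (\<sigma> p, \<sigma> q)"
    using block_rep_rotate[OF \<zeta> r n] by blast
  have "block_dim (rotate1 \<Lambda>) = block_dim \<Lambda>" and "sum_list (map sum_list (rotate1 \<Lambda>)) = n"
    using n by (cases \<Lambda>; simp add: block_dim_def mult.commute)+
  then have R': "matrix_subgroup_rep (wreath n r) (block_subgroup n r (map sum_list (rotate1 \<Lambda>)))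
      (block_rep \<zeta> (rotate1 \<Lambda>)) (block_dim \<Lambda>)"
    using matrix_subgroup_rep_block_rep[OF \<zeta> r(2), of "rotate1 \<Lambda>" n] by simp
  have "\<zeta> \<noteq> 0"
    using \<zeta> r(2) by (auto simp: power_0_left)
  note facts = det_induced_rep_conjugate[OF matrix_subgroup_rep_block_rep[OF \<zeta> r(2) n] R' u mem \<sigma>
      zeta_char_nonzero[OF this] zeta_char_mult[OF \<zeta> r(2)] entry g]
  show "dim_row (wreath_irrep \<zeta> n r \<Lambda> g) = dim_row (wreath_irrep \<zeta> n r (rotate1 \<Lambda>) g)"
    and "det (wreath_irrep \<zeta> n r \<Lambda> g) =
      zeta_char \<zeta> n g ^ dim_row (wreath_irrep \<zeta> n r \<Lambda> g) * det (wreath_irrep \<zeta> n r (rotate1 \<Lambda>) g)"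
    using facts r(1) by (simp_all add: wreath_irrep_eq)
qed

section \<open>The dimension modulo \<open>r\<close>\<close>

lemma prime_not_dvd_prod_list:
  assumes "prime (p::nat)" "\<And>x. x \<in> set xs \<Longrightarrow> \<not> p dvd x"
  shows "\<not> p dvd prod_list xs"
  using assms by (induction xs) (auto simp: prime_dvd_mult_iff)

lemma dim_wreath_irrep:
  assumes \<zeta>: "\<zeta> ^ r = 1" and r: "prime r" "n < r" and \<Lambda>: "\<Lambda> \<in> multipartitions n r"
  shows "dim_row (wreath_irrep \<zeta> n r \<Lambda> g) = dim_row (wreath_irrep \<zeta> n r \<Lambda> h)"
    and "coprime (dim_row (wreath_irrep \<zeta> n r \<Lambda> g)) r"
proof -
  have r0: "0 < r"
    using r by (simp add: prime_gt_0_nat)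
  have len: "length \<Lambda> = r" and n: "sum_list (map sum_list \<Lambda>) = n" and part: "\<And>\<mu>. \<mu> \<in> set \<Lambda> \<Longrightarrow> is_partition \<mu>"
    using \<Lambda> by (auto simp: multipartitions_def)
  define as where "as = map sum_list \<Lambda>"
  interpret matrix_subgroup_rep "wreath n r" "block_subgroup n r as" "block_rep \<zeta> \<Lambda>" "block_dim \<Lambda>"
    unfolding as_def by (rule matrix_subgroup_rep_block_rep[OF \<zeta> r0 n])
  have dim: "dim_row (wreath_irrep \<zeta> n r \<Lambda> g) = length transversal * block_dim \<Lambda>" for g
    by (simp add: wreath_irrep_eq[OF len] induced_rep_eq flip: as_def)
  then show "dim_row (wreath_irrep \<zeta> n r \<Lambda> g) = dim_row (wreath_irrep \<zeta> n r \<Lambda> h)"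
    by simp
  have fact: "\<not> r dvd fact m" if "m \<le> n" for m
    using that r by (simp add: prime_dvd_fact_iff)
  \<comment> \<open>Both group orders contain the factor \<open>r ^ n\<close>; only after cancelling
    it does \<open>fact n\<close> control the divisors of the index.\<close>
  have "length transversal * (r ^ n * card (block_perms n as)) = r ^ n * fact n"
    using length_left_transversal[OF fin subgroup_H left_transversal_transversal]
    by (simp add: block_subgroup_eq[OF r0] wreath_carrier[OF r0] card_cartesian_product card_PiE card_permutations)
  then have "r ^ n * (length transversal * card (block_perms n as)) = r ^ n * fact n"
    by (simp add: mult_ac)
  then have "length transversal * card (block_perms n as) = fact n"
    using r0 by simp
  then have "\<not> r dvd length transversal"
    using fact[of n] by (metis dvd_mult2 order_refl)
  moreover have "\<not> r dvd block_dim \<Lambda>"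
    unfolding block_dim_def
  proof (rule prime_not_dvd_prod_list[OF r(1)])
    fix x assume "x \<in> set (map specht_dim \<Lambda>)"
    then obtain \<mu> where \<mu>: "\<mu> \<in> set \<Lambda>" "x = specht_dim \<mu>"
      by auto
    then have "sum_list \<mu> \<le> n"
      using member_le_sum_list[of "sum_list \<mu>" "map sum_list \<Lambda>"] n by simp
    then show "\<not> r dvd x"
      using specht_dim_dvd_fact[OF part[OF \<mu>(1)]] fact \<mu>(2) dvd_trans by blast
  qed
  ultimately have "\<not> r dvd dim_row (wreath_irrep \<zeta> n r \<Lambda> g)"
    by (simp add: dim prime_dvd_mult_iff[OF r(1)])
  then show "coprime (dim_row (wreath_irrep \<zeta> n r \<Lambda> g)) r"
    using r(1) by (simp add: prime_imp_coprime coprime_commute)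
qed

section \<open>Counting multipartitions by rotation\<close>

lemma length_le_sum_list: "0 \<notin> set xs \<Longrightarrow> length xs \<le> sum_list (xs :: nat list)"
  by (induction xs) auto

text \<open>An injection bounds \<open>card\<close> only if the target is finite. Parts are
  positive, so their sizes and their number are at most \<open>n\<close>.\<close>

lemma finite_multipartitions: "finite (multipartitions n r)"
proof -
  have "set \<mu> \<subseteq> {..n} \<and> length \<mu> \<le> n" if "\<Lambda> \<in> multipartitions n r" "\<mu> \<in> set \<Lambda>" for \<Lambda> \<mu>
  proof -
    have "sum_list \<mu> \<le> n"
      using that member_le_sum_list[of "sum_list \<mu>" "map sum_list \<Lambda>"] by (simp add: multipartitions_def)
    moreover have "0 \<notin> set \<mu>"
      using that by (auto simp: multipartitions_def is_partition_def)
    ultimately show ?thesis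
      using length_le_sum_list[of \<mu>] member_le_sum_list[of _ \<mu>] by (force intro: order_trans)
  qed
  then have "multipartitions n r \<subseteq> {\<Lambda>. set \<Lambda> \<subseteq> {\<mu>. set \<mu> \<subseteq> {..n} \<and> length \<mu> \<le> n} \<and> length \<Lambda> = r}"
    by (auto simp: multipartitions_def)
  then show ?thesis
    by (rule finite_subset) (intro finite_lists_length_eq finite_lists_length_le finite_atMost)
qed

lemma rotate1_multipartitions: "\<Lambda> \<in> multipartitions n r \<Longrightarrow> rotate1 \<Lambda> \<in> multipartitions n r"
  by (cases \<Lambda>) (auto simp: multipartitions_def)

lemma rotate_multipartitions: "\<Lambda> \<in> multipartitions n r \<Longrightarrow> rotate j \<Lambda> \<in> multipartitions n r"
  by (induction j) (simp_all add: rotate1_multipartitions)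

text \<open>The dimension is carried along in the induction because it is the exponent gained at
  each step.\<close>

lemma det_wreath_irrep_rotate:
  assumes \<zeta>: "\<zeta> ^ r = 1" "0 < r" and \<Lambda>: "\<Lambda> \<in> multipartitions n r" and g: "g \<in> carrier (wreath n r)"
  shows "dim_row (wreath_irrep \<zeta> n r (rotate j \<Lambda>) g) = dim_row (wreath_irrep \<zeta> n r \<Lambda> g) \<and>
    det (wreath_irrep \<zeta> n r \<Lambda> g) =
      zeta_char \<zeta> n g ^ (j * dim_row (wreath_irrep \<zeta> n r \<Lambda> g)) * det (wreath_irrep \<zeta> n r (rotate j \<Lambda>) g)"
proof (induction j)
  case (Suc j)
  have "rotate j \<Lambda> \<in> multipartitions n r"
    by (rule rotate_multipartitions[OF \<Lambda>])
  then show ?case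
    using det_wreath_irrep_rotate1[OF \<zeta>(1) _ \<zeta>(2) _ g, of "rotate j \<Lambda>"] Suc
    by (simp add: multipartitions_def power_add mult_ac)
qed simp

text \<open>The function \<open>f\<close> carries the sign: it is constantly 1 for
  \<open>N_plus\<close> and \<open>sgn_char\<close> for \<open>N_minus\<close>.\<close>

lemma card_det_le:
  assumes \<zeta>: "\<zeta> ^ r = 1" and r: "prime r" "n < r" and t: "t \<le> r"
  shows "card {\<Lambda> \<in> multipartitions n r. \<forall>g\<in>carrier (wreath n r).
      det (wreath_irrep \<zeta> n r \<Lambda> g) = zeta_char \<zeta> n g ^ s * f g} \<le>
    card {\<Lambda> \<in> multipartitions n r. \<forall>g\<in>carrier (wreath n r).
      det (wreath_irrep \<zeta> n r \<Lambda> g) = zeta_char \<zeta> n g ^ t * f g}" (is "card ?S \<le> card ?T")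
proof -
  define D where "D \<Lambda> = dim_row (wreath_irrep \<zeta> n r \<Lambda> \<one>\<^bsub>wreath n r\<^esub>)" for \<Lambda>
  have r0: "0 < r"
    using r by (simp add: prime_gt_0_nat)
  have nz: "\<zeta> \<noteq> 0"
    using \<zeta> r0 by (auto simp: power_0_left)
  have one: "\<one>\<^bsub>wreath n r\<^esub> \<in> carrier (wreath n r)"
    by (rule monoid.one_closed[OF group.is_monoid[OF group_wreath[OF r0]]])
  \<comment> \<open>With \<open>x\<close> inverse to \<open>d\<close> modulo \<open>r\<close> the
    witness is \<open>x * (s + (r - t))\<close>. Here \<open>r - t\<close> stands for minus
    \<open>t\<close>, and \<open>t \<le> r\<close> keeps the subtraction exact.\<close>
  have ex: "\<exists>j. [t + j * d = s] (mod r)" if d: "coprime d r" for d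
  proof -
    obtain x where x: "[d * x = 1] (mod r)"
      using cong_solve_coprime_nat[OF d] by auto
    have "[t + (d * x) * (s + (r - t)) = t + 1 * (s + (r - t))] (mod r)"
      by (intro cong_add cong_mult cong_refl x)
    moreover have "t + 1 * (s + (r - t)) = s + r"
      using t by simp
    ultimately have "[t + (x * (s + (r - t))) * d = s] (mod r)"
      by (simp add: cong_def mult_ac)
    then show ?thesis ..
  qed
  define J where "J d = (SOME j. [t + j * d = s] (mod r))" for d
  have J: "[t + J d * d = s] (mod r)" if "coprime d r" for d
    unfolding J_def by (rule someI_ex[OF ex[OF that]])
  have D_rot: "D (rotate j \<Lambda>) = D \<Lambda>" if "\<Lambda> \<in> multipartitions n r" for j \<Lambda>
    using det_wreath_irrep_rotate[OF \<zeta> r0 that one] by (simp add: D_def)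
  let ?\<rho> = "\<lambda>\<Lambda>. rotate (J (D \<Lambda>)) \<Lambda>"
  have "inj_on ?\<rho> ?S"
  proof (rule inj_onI)
    fix \<Lambda> M assume mem: "\<Lambda> \<in> ?S" "M \<in> ?S" and eq: "?\<rho> \<Lambda> = ?\<rho> M"
    \<comment> \<open>Rotation keeps the dimension, so equal images come from the same number of
      steps, and a fixed rotation is injective.\<close>
    from mem have "D (?\<rho> \<Lambda>) = D \<Lambda>" "D (?\<rho> M) = D M"
      by (auto simp: D_rot)
    then have "D \<Lambda> = D M"
      using eq by simp
    then have "rotate (J (D M)) \<Lambda> = rotate (J (D M)) M"
      using eq by simp
    then show "\<Lambda> = M"
      unfolding rotate_def by (rule injD[OF inj_fn[OF inj_rotate1]])
  qed
  moreover have "?\<rho> ` ?S \<subseteq> ?T"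
  proof clarify
    fix \<Lambda> assume \<Lambda>: "\<Lambda> \<in> multipartitions n r"
      and det: "\<forall>g\<in>carrier (wreath n r). det (wreath_irrep \<zeta> n r \<Lambda> g) = zeta_char \<zeta> n g ^ s * f g"
    show "?\<rho> \<Lambda> \<in> multipartitions n r \<and> (\<forall>g\<in>carrier (wreath n r).
      det (wreath_irrep \<zeta> n r (?\<rho> \<Lambda>) g) = zeta_char \<zeta> n g ^ t * f g)"
    proof (intro conjI ballI)
      show "?\<rho> \<Lambda> \<in> multipartitions n r"
        by (rule rotate_multipartitions[OF \<Lambda>])
      fix g assume g: "g \<in> carrier (wreath n r)"
      let ?z = "zeta_char \<zeta> n g"
      have dim: "dim_row (wreath_irrep \<zeta> n r \<Lambda> g) = D \<Lambda>" and cop: "coprime (D \<Lambda>) r"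
        unfolding D_def by (rule dim_wreath_irrep[OF \<zeta> r \<Lambda>])+
      have pow_mod: "?z ^ a = ?z ^ (a mod r)" for a
      proof -
        have "?z ^ a = ?z ^ (r * (a div r) + a mod r)"
          by simp
        also have "\<dots> = (?z ^ r) ^ (a div r) * ?z ^ (a mod r)"
          by (simp only: power_add power_mult)
        finally show ?thesis
          by (simp add: zeta_char_power[OF \<zeta>])
      qed
      have "?z ^ s = ?z ^ (t + J (D \<Lambda>) * D \<Lambda>)"
        using J[OF cop] pow_mod by (metis cong_def)
      then have "?z ^ (J (D \<Lambda>) * D \<Lambda>) * (?z ^ t * f g) = det (wreath_irrep \<zeta> n r \<Lambda> g)"
        using det g by (simp add: power_add)
      also have "\<dots> = ?z ^ (J (D \<Lambda>) * D \<Lambda>) * det (wreath_irrep \<zeta> n r (?\<rho> \<Lambda>) g)"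
        using det_wreath_irrep_rotate[OF \<zeta> r0 \<Lambda> g, of "J (D \<Lambda>)"] by (simp add: dim)
      finally show "det (wreath_irrep \<zeta> n r (?\<rho> \<Lambda>) g) = ?z ^ t * f g"
        using zeta_char_nonzero[OF nz, of n g] by simp
    qed
  qed
  moreover have "finite ?T"
    using finite_multipartitions by simp
  ultimately show ?thesis
    by (rule card_inj_on_le)
qed

theorem theorem8:
  fixes r n :: nat and \<zeta> :: complex
  assumes "Factorial_Ring.prime r" and "odd r"
    and "primitive_root_of_unity r \<zeta>"
    and "1 \<le> n" and "n < r"
  shows "(\<forall>s\<in>{1..r}. \<forall>t\<in>{1..r}. N_plus \<zeta> r s n = N_plus \<zeta> r t n) \<and>
         (\<forall>s\<in>{1..r}. \<forall>t\<in>{1..r}. N_minus \<zeta> r s n = N_minus \<zeta> r t n)"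
proof -
  have \<zeta>: "\<zeta> ^ r = 1"
    using assms(3) by (simp add: primitive_root_of_unity_def)
  note le = card_det_le[OF \<zeta> assms(1,5)]
  have "N_plus \<zeta> r s n \<le> N_plus \<zeta> r t n" if "t \<in> {1..r}" for s t
    using le[of t s "\<lambda>_. 1"] that by (simp add: N_plus_def)
  \<comment> \<open>For \<open>n = 1\<close> both numbers are 0 by definition.\<close>
  moreover have "N_minus \<zeta> r s n \<le> N_minus \<zeta> r t n" if "t \<in> {1..r}" for s t
    using le[of t s sgn_char] that by (simp add: N_minus_def)
  ultimately show ?thesis
    by (meson order_antisym)
qed

end
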